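(* Let $\mu$ be a positive measure on $\mathbf{R}$ with moments of every order and with infinite support, and let $\{p_n(x)\}_{n\ge 0}$ be polynomials with real coefficients, $\deg p_n=n$, which are orthogonal with respect to $\mu$: $$\int_{-\infty}^{\infty} p_n(x)p_m(x)\,d\mu(x)=\zeta_n\delta_{m,n}\qquad (m,n\ge 0).$$ Let $\{c_n\}_{n\ge 0}$ be a sequence of nonzero numbers, and assume that the power series $$\sum_{n=0}^\infty \frac{\sqrt{\zeta_n}}{c_n}z^n$$ has radius of convergence $\rho$ with $0<\rho\le\infty$. Consider the series $$G(x,t)=\sum_{n=0}^\infty p_n(x)\frac{t^n}{c_n}. \qquad ( * )$$ (i) There is a $\mu$-null set $N\subseteq\mathbf{R}$ such that $( * )$ converges absolutely for all $|t|<\rho$ and $x\in\mathbf{R}\setminus N$. Furthermore, $( * )$ converges in $L^2(\mu)$ for $|t|<\rho$, and $$\int_{-\infty}^\infty G(x,t_1)G(x,t_2)\,d\mu(x)=\sum_{n=0}^\infty \zeta_n\frac{(t_1t_2)^n}{c_n^2}\qquad\text{for } |t_1|,|t_2|<\rho.$$ (ii) If $\mu$ is indeterminate, then $( * )$ converges absolutely and uniformly on compact subsets of $\Omega=\mathbf{C}\times D(0,\rho)$, and $G$ is holomorphic in $\Omega$.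
   Context: $D(0,\rho)$ denotes the set of $z\in\mathbf{C}$ with $|z|<\rho$ (so $D(0,\infty)=\mathbf{C}$). A positive measure $\mu$ on $\mathbf{R}$ with moments of every order is called indeterminate if there is a positive measure on $\mathbf{R}$ different from $\mu$ having the same moments $\int x^n\,d\mu(x)$ for all $n\ge 0$. *)

theory Defs
  imports "HOL-Analysis.Analysis" "HOL-Computational_Algebra.Polynomial"
begin

text \<open>The case \<open>n = 0\<close> forces such a measure to be finite.\<close>

definition has_all_moments :: "real measure \<Rightarrow> bool" where
  "has_all_moments \<mu> \<longleftrightarrow> sets \<mu> = sets borel \<and> (\<forall>n::nat. integrable \<mu> (\<lambda>x. x ^ n))"

definition measure_support :: "'a::topological_space measure \<Rightarrow> 'a set" where
  "measure_support \<mu> = {x. \<forall>U. open U \<longrightarrow> x \<in> U \<longrightarrow> emeasure \<mu> U > 0}"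

definition indeterminate :: "real measure \<Rightarrow> bool" where
  "indeterminate \<mu> \<longleftrightarrow> has_all_moments \<mu> \<and>
     (\<exists>\<nu>. has_all_moments \<nu> \<and> \<nu> \<noteq> \<mu> \<and> (\<forall>n::nat. (LINT x|\<nu>. x ^ n) = (LINT x|\<mu>. x ^ n)))"

definition square_integrable :: "'a measure \<Rightarrow> ('a \<Rightarrow> complex) \<Rightarrow> bool" where
  "square_integrable M f \<longleftrightarrow> f \<in> borel_measurable M \<and> integrable M (\<lambda>x. (norm (f x))\<^sup>2)"

definition norm_L2 :: "'a measure \<Rightarrow> ('a \<Rightarrow> complex) \<Rightarrow> real" where
  "norm_L2 M f = sqrt (LINT x|M. (norm (f x))\<^sup>2)"

text \<open>The Bochner integral in \<^const>\<open>norm_L2\<close> is \<open>0\<close> for non-integrable functions, hence the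
  explicit membership conditions.\<close>

definition converges_in_L2 :: "'a measure \<Rightarrow> (nat \<Rightarrow> 'a \<Rightarrow> complex) \<Rightarrow> ('a \<Rightarrow> complex) \<Rightarrow> bool" where
  "converges_in_L2 M F f \<longleftrightarrow> (\<forall>n. square_integrable M (F n)) \<and> square_integrable M f \<and>
     (\<lambda>n. norm_L2 M (\<lambda>x. F n x - f x)) \<longlonglongrightarrow> 0"

text \<open>Holomorphy in two variables: total complex differentiability at every point of the
  (open) set, i.e. the Frechet derivative exists and is complex linear on \<open>\<complex> \<times> \<complex>\<close>.\<close>

definition holomorphic2_on :: "(complex \<times> complex \<Rightarrow> complex) \<Rightarrow> (complex \<times> complex) set \<Rightarrow> bool" where
  "holomorphic2_on f S \<longleftrightarrow>
     (\<forall>w\<in>S. \<exists>a b. (f has_derivative (\<lambda>(h, k). a * h + b * k)) (at w))"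

definition gen_term ::
  "(nat \<Rightarrow> real poly) \<Rightarrow> (nat \<Rightarrow> complex) \<Rightarrow> nat \<Rightarrow> complex \<Rightarrow> complex \<Rightarrow> complex" where
  "gen_term p c n x t = poly (map_poly complex_of_real (p n)) x * (t ^ n / c n)"

definition gen_fun ::
  "(nat \<Rightarrow> real poly) \<Rightarrow> (nat \<Rightarrow> complex) \<Rightarrow> complex \<Rightarrow> complex \<Rightarrow> complex" where
  "gen_fun p c x t = (\<Sum>n. gen_term p c n x t)"

end

theory Submission
  imports Defs "HOL-Probability.Distribution_Functions" "HOL-Complex_Analysis.Cauchy_Integral_Formula"
    "HOL-Real_Asymp.Real_Asymp"
begin

text \<open>
  With \<open>P n = p n / sqrt (\<zeta> n)\<close> orthonormal, the series is \<open>\<Sum>n. a n * P n\<close> with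
  \<open>a n = sqrt (\<zeta> n) * t ^ n / c n\<close> absolutely summable. The \<open>L\<^sup>1\<close> norms of the \<open>P n\<close> are bounded,
  which gives absolute convergence almost everywhere (simultaneously in \<open>t\<close>, by letting \<open>\<bar>t\<bar>\<close> run
  through the rationals below \<open>\<rho>\<close>); orthogonality and Fatou's lemma give \<open>L\<^sup>2\<close> convergence.

  If \<open>\<nu> \<noteq> \<mu>\<close> has the same moments, the Stieltjes transforms differ at some non-real \<open>z\<close>.
  Integrating \<open>P n (x) / (x - z)\<close> against both measures, Bessel's inequality puts
  \<open>Q n + w * P n (z)\<close> in \<open>\<ell>\<^sup>2\<close> for two different values of \<open>w\<close>, where \<open>Q n\<close> is the polynomial of the
  second kind at \<open>z\<close>; so \<open>P n (z)\<close> and \<open>Q n\<close> are in \<open>\<ell>\<^sup>2\<close>. Expanding \<open>(P n (x) - P n (z)) / (x - z)\<close>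
  in the \<open>P k\<close>, \<open>k < n\<close>, expresses \<open>P n (w)\<close> through the \<open>P k (w)\<close> by a Volterra equation with square
  summable kernel, and a discrete Gronwall argument bounds \<open>P n (w)\<close> locally uniformly in \<open>w\<close>.
\<close>

subsection \<open>Uniqueness of the Stieltjes transform\<close>

definition stieltjes :: "real measure \<Rightarrow> complex \<Rightarrow> complex" where
  "stieltjes \<mu> z = (LINT x|\<mu>. 1 / (complex_of_real x - z))"

lemma abs_arctan_le: "\<bar>arctan x\<bar> \<le> pi / 2"
  using arctan_lbound[of x] arctan_ubound[of x] by linarith

lemma norm_resolvent_le: "Im z \<noteq> 0 \<Longrightarrow> norm (1 / (complex_of_real x - z)) \<le> 1 / \<bar>Im z\<bar>"
proof -
  assume z: "Im z \<noteq> 0"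
  have "\<bar>Im z\<bar> \<le> norm (complex_of_real x - z)"
    using abs_Im_le_cmod[of "complex_of_real x - z"] by simp
  with z show ?thesis by (simp add: norm_divide divide_simps)
qed

lemma integrable_resolvent:
  assumes "finite_measure \<mu>" "sets \<mu> = sets borel" "Im z \<noteq> 0"
  shows "integrable \<mu> (\<lambda>x. 1 / (complex_of_real x - z))"
proof -
  interpret finite_measure \<mu> by fact
  note assms(2)[measurable_cong]
  show ?thesis
    by (rule integrable_const_bound[where B = "1 / \<bar>Im z\<bar>"])
       (use norm_resolvent_le[OF assms(3)] in auto)
qed

text \<open>The integrand is \<open>pi\<close> times the Poisson kernel of the upper half plane; as
  a function of \<open>b\<close> it is the derivative of
  \<open>arctan ((b - s) / y)\<close>.\<close>

lemma Im_stieltjes: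
  assumes "finite_measure \<mu>" "sets \<mu> = sets borel" "y > 0"
  shows "Im (stieltjes \<mu> (Complex b y)) = (LINT s|\<mu>. y / ((b - s)\<^sup>2 + y\<^sup>2))"
proof -
  have "Im (stieltjes \<mu> (Complex b y)) = (LINT s|\<mu>. Im (1 / (complex_of_real s - Complex b y)))"
    unfolding stieltjes_def using integrable_resolvent[OF assms(1,2), of "Complex b y"] assms(3)
    by simp
  also have "\<dots> = (LINT s|\<mu>. y / ((b - s)\<^sup>2 + y\<^sup>2))"
    by (rule Bochner_Integration.integral_cong) (simp_all add: Im_divide power2_commute)
  finally show ?thesis .
qed

text \<open>The arctan integral is the Poisson integral of the distribution function, so this replaces
  Fubini's theorem in the Stieltjes inversion.\<close>

lemma has_field_derivative_integral_arctan:
  assumes "finite_measure \<mu>" "sets \<mu> = sets borel" "y > 0"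
  shows "((\<lambda>b. LINT s|\<mu>. arctan ((b - s) / y)) has_field_derivative
           Im (stieltjes \<mu> (Complex b y))) (at b)"
proof -
  interpret finite_measure \<mu> by fact
  note assms(2)[measurable_cong]
  have [measurable]: "arctan \<in> borel_measurable borel"
    by (intro borel_measurable_continuous_onI continuous_intros)
  have int: "integrable \<mu> (\<lambda>s. arctan ((b - s) / y))" for b
    by (rule integrable_const_bound[where B = "pi / 2"])
       (use abs_arctan_le in auto)
  have der: "((\<lambda>b. arctan ((b - s) / y)) has_field_derivative y / ((b - s)\<^sup>2 + y\<^sup>2)) (at b)" for s b
    using assms(3) by (auto intro!: derivative_eq_intros simp: field_simps power2_eq_square)
  have bnd: "\<bar>y / ((b - s)\<^sup>2 + y\<^sup>2)\<bar> \<le> 1 / y" for b s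
  proof -
    have "y / ((b - s)\<^sup>2 + y\<^sup>2) \<le> y / y\<^sup>2"
      using assms(3) by (intro divide_left_mono mult_pos_pos add_nonneg_pos) auto
    with assms(3) show ?thesis by (simp add: power2_eq_square)
  qed
  \<comment> \<open>The mean value theorem turns the bound on the derivative into a bound on all
    difference quotients, uniform in \<open>s\<close>; on a finite measure the constant
    \<open>1 / y\<close> is an integrable majorant.\<close>
  have lip: "\<bar>arctan ((u - s) / y) - arctan ((v - s) / y)\<bar> \<le> 1 / y * \<bar>u - v\<bar>" for u v s
    using field_differentiable_bound[of UNIV "\<lambda>b. arctan ((b - s) / y)" "\<lambda>b. y / ((b - s)\<^sup>2 + y\<^sup>2)" "1 / y" u v]
      der bnd by auto
  show ?thesis
    unfolding DERIV_def Im_stieltjes[OF assms] tendsto_at_iff_sequentially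
  proof (intro allI impI)
    fix h :: "nat \<Rightarrow> real" assume h: "\<forall>i. h i \<in> UNIV - {0}" "h \<longlonglongrightarrow> 0"
    have "(\<lambda>i. LINT s|\<mu>. (arctan ((b + h i - s) / y) - arctan ((b - s) / y)) / h i)
       \<longlonglongrightarrow> (LINT s|\<mu>. y / ((b - s)\<^sup>2 + y\<^sup>2))"
    proof (rule integral_dominated_convergence[where w = "\<lambda>_. 1 / y"])
      show "AE s in \<mu>. (\<lambda>i. (arctan ((b + h i - s) / y) - arctan ((b - s) / y)) / h i)
         \<longlonglongrightarrow> y / ((b - s)\<^sup>2 + y\<^sup>2)"
      proof (rule AE_I2)
        fix s
        show "(\<lambda>i. (arctan ((b + h i - s) / y) - arctan ((b - s) / y)) / h i)
         \<longlonglongrightarrow> y / ((b - s)\<^sup>2 + y\<^sup>2)"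
          using der[of s b] h unfolding DERIV_def tendsto_at_iff_sequentially by (auto simp: o_def)
      qed
      show "AE s in \<mu>. norm ((arctan ((b + h i - s) / y) - arctan ((b - s) / y)) / h i) \<le> 1 / y" for i
        using lip[of "b + h i" _ b] h(1) by (auto simp: divide_simps)
    qed auto
    then show "((\<lambda>h. ((LINT s|\<mu>. arctan ((b + h - s) / y)) - (LINT s|\<mu>. arctan ((b - s) / y))) / h) \<circ> h)
       \<longlonglongrightarrow> (LINT s|\<mu>. y / ((b - s)\<^sup>2 + y\<^sup>2))"
      by (simp add: o_def int)
  qed
qed

text \<open>Dominated convergence with the constant \<open>pi / 2\<close>. It serves both limits of
  the inversion: \<open>b\<close> to minus infinity, and \<open>y\<close> to 0.\<close>

lemma LIMSEQ_integral_arctan: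
  assumes "finite_measure \<mu>" "sets \<mu> = sets borel"
    and "\<And>s. (\<lambda>n. arctan (f n s)) \<longlonglongrightarrow> g s" "\<And>n. f n \<in> borel_measurable borel" "g \<in> borel_measurable borel"
  shows "(\<lambda>n. LINT s|\<mu>. arctan (f n s)) \<longlonglongrightarrow> (LINT s|\<mu>. g s)"
proof (rule integral_dominated_convergence[where w = "\<lambda>_. pi / 2"])
  interpret finite_measure \<mu> by fact
  note assms(2)[measurable_cong]
  have [measurable]: "arctan \<in> borel_measurable borel"
    by (intro borel_measurable_continuous_onI continuous_intros)
  note assms(4,5)[measurable]
  show "(\<lambda>s. arctan (f n s)) \<in> borel_measurable \<mu>" for n by measurable
  show "g \<in> borel_measurable \<mu>" by measurable
  show "integrable \<mu> (\<lambda>_. pi / 2)" by simp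
  show "AE s in \<mu>. norm (arctan (f n s)) \<le> pi / 2" for n
    using abs_arctan_le by simp
  show "AE s in \<mu>. (\<lambda>n. arctan (f n s)) \<longlonglongrightarrow> g s" using assms(3) by simp
qed

text \<open>Equal transforms give the two arctan integrals the same derivative in \<open>b\<close>,
  so for each \<open>y\<close> they differ by a constant, which is 0 because the masses agree.
  Letting \<open>y\<close> tend to 0 recovers the distribution functions, and these determine the
  measures.\<close>

lemma stieltjes_inject:
  assumes "finite_measure \<mu>" "sets \<mu> = sets borel" "finite_measure \<nu>" "sets \<nu> = sets borel"
    and mass: "measure \<mu> UNIV = measure \<nu> UNIV"
    and eq: "\<And>z. Im z > 0 \<Longrightarrow> stieltjes \<mu> z = stieltjes \<nu> z"
  shows "\<mu> = \<nu>"
proof -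
  interpret \<mu>: finite_measure \<mu> by fact
  interpret \<nu>: finite_measure \<nu> by fact
  note assms(2)[measurable_cong] assms(4)[measurable_cong]
  have sp: "space \<mu> = UNIV" "space \<nu> = UNIV"
    using sets_eq_imp_space_eq[OF assms(2)] sets_eq_imp_space_eq[OF assms(4)] by auto
  define F where "F = (\<lambda>M y b. LINT s|M. arctan ((b - s) / y))"
  have F_eq: "F \<mu> y b = F \<nu> y b" if y: "y > 0" for y b
  proof -
    have "((\<lambda>b. F \<mu> y b - F \<nu> y b) has_field_derivative 0) (at b)" for b
      unfolding F_def
      using DERIV_diff[OF has_field_derivative_integral_arctan[OF assms(1,2) y, of b]
          has_field_derivative_integral_arctan[OF assms(3,4) y, of b]] eq[of "Complex b y"] y by simp
    then have const: "F \<mu> y b - F \<nu> y b = F \<mu> y b' - F \<nu> y b'" for b b'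
      by (intro DERIV_isconst_all) auto
    \<comment> \<open>As \<open>b\<close> tends to minus infinity, each integral tends to
      \<open>- pi / 2\<close> times the total mass, so equal masses make the constant 0.\<close>
    have lim: "(\<lambda>n. arctan ((- real n - s) / y)) \<longlonglongrightarrow> - (pi / 2)" for s
      using y by real_asymp
    have "(\<lambda>n. F \<mu> y (- real n) - F \<nu> y (- real n)) \<longlonglongrightarrow> (LINT s|\<mu>. - (pi / 2)) - (LINT s|\<nu>. - (pi / 2))"
      unfolding F_def by (intro tendsto_diff LIMSEQ_integral_arctan assms lim) auto
    moreover have "(\<lambda>n. F \<mu> y (- real n) - F \<nu> y (- real n)) = (\<lambda>_. F \<mu> y b - F \<nu> y b)"
      by (intro ext const)
    ultimately have "(\<lambda>n::nat. F \<mu> y b - F \<nu> y b) \<longlonglongrightarrow> 0"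
      using mass sp by simp
    then show ?thesis by (simp add: LIMSEQ_const_iff)
  qed
  have "measure \<mu> {..b} = measure \<nu> {..b}" for b
  proof -
    \<comment> \<open>Approaching \<open>b\<close> from the right more slowly than \<open>y\<close> tends to \<open>0\<close> puts a possible atom at \<open>b\<close>
      entirely on the left.\<close>
    define g where "g = (\<lambda>s. pi * indicator {..b} s - pi / 2)"
    have lim: "(\<lambda>n. arctan ((b + 1 / Suc n - s) / (1 / Suc n ^ 2))) \<longlonglongrightarrow> g s" for s
    proof (cases "s \<le> b")
      case True
      \<comment> \<open>At \<open>s = b\<close> the quotient is exactly \<open>Suc n\<close>, and
        for smaller \<open>s\<close> it is larger.\<close>
      have "filterlim (\<lambda>n. (b + 1 / Suc n - s) / (1 / Suc n ^ 2)) at_top sequentially"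
      proof (rule filterlim_at_top_mono)
        show "filterlim (\<lambda>n. real (Suc n)) at_top sequentially" by real_asymp
        show "\<forall>\<^sub>F n in sequentially. real (Suc n) \<le> (b + 1 / Suc n - s) / (1 / Suc n ^ 2)"
        proof (rule always_eventually, rule allI)
          fix n
          have "real (Suc n) = (1 / Suc n) / (1 / Suc n ^ 2)"
            by (simp add: power2_eq_square del: of_nat_Suc mult_Suc mult_Suc_right)
          also have "\<dots> \<le> (b + 1 / Suc n - s) / (1 / Suc n ^ 2)"
            using True by (intro divide_right_mono) auto
          finally show "real (Suc n) \<le> (b + 1 / Suc n - s) / (1 / Suc n ^ 2)" .
        qed
      qed
      from filterlim_compose[OF tendsto_arctan_at_top this] True show ?thesis
        by (simp add: g_def)
    next
      case False
      have "filterlim (\<lambda>n. (b + 1 / Suc n - s) / (1 / Suc n ^ 2)) at_bot sequentially"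
      proof -
        have "b - s < 0" using False by simp
        then show ?thesis by real_asymp
      qed
      from filterlim_compose[OF tendsto_arctan_at_bot this] False show ?thesis
        by (simp add: g_def)
    qed
    have "(\<lambda>n. F \<mu> (1 / Suc n ^ 2) (b + 1 / Suc n)) \<longlonglongrightarrow> (LINT s|\<mu>. g s)"
      unfolding F_def g_def by (intro LIMSEQ_integral_arctan assms lim[unfolded g_def]) auto
    moreover have "(\<lambda>n. F \<nu> (1 / Suc n ^ 2) (b + 1 / Suc n)) \<longlonglongrightarrow> (LINT s|\<nu>. g s)"
      unfolding F_def g_def by (intro LIMSEQ_integral_arctan assms lim[unfolded g_def]) auto
    ultimately have eq: "(LINT s|\<mu>. g s) = (LINT s|\<nu>. g s)"
      using F_eq LIMSEQ_unique by auto
    have "(LINT s|\<mu>. g s) = pi * measure \<mu> {..b} - pi / 2 * measure \<mu> UNIV"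
      unfolding g_def
      by (subst Bochner_Integration.integral_diff)
         (auto simp: sp assms(2) \<mu>.emeasure_eq_measure intro!: integrable_mult_right)
    moreover have "(LINT s|\<nu>. g s) = pi * measure \<nu> {..b} - pi / 2 * measure \<nu> UNIV"
      unfolding g_def
      by (subst Bochner_Integration.integral_diff)
         (auto simp: sp assms(4) \<nu>.emeasure_eq_measure intro!: integrable_mult_right)
    ultimately show ?thesis using eq mass by simp
  qed
  then have "cdf \<mu> = cdf \<nu>" by (simp add: cdf_def fun_eq_iff)
  moreover have "finite_borel_measure \<mu>" "finite_borel_measure \<nu>"
    by (unfold_locales; use assms in simp)+
  ultimately show ?thesis by (intro cdf_unique')
qed

subsection \<open>Orthonormal polynomials\<close>

lemma has_all_moments_imp_finite_measure:
  assumes "has_all_moments \<mu>" shows "finite_measure \<mu>"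
proof
  have "integrable \<mu> (\<lambda>x::real. x ^ 0)" using assms unfolding has_all_moments_def by blast
  then show "emeasure \<mu> (space \<mu>) \<noteq> \<infinity>" by (auto simp: integrable_iff_bounded)
qed

lemma integrable_complex_poly:
  assumes "has_all_moments \<mu>"
  shows "integrable \<mu> (\<lambda>x. poly q (complex_of_real x))"
proof -
  have "integrable \<mu> (\<lambda>x. \<Sum>i\<le>degree q. coeff q i * complex_of_real (x ^ i))"
    using assms unfolding has_all_moments_def
    by (intro Bochner_Integration.integrable_sum integrable_mult_right integrable_of_real) auto
  then show ?thesis by (simp add: poly_altdef)
qed

section \<open>The moment functional on complex polynomials\<close>

definition moment_functional :: "real measure \<Rightarrow> complex poly \<Rightarrow> complex" where
  "moment_functional \<mu> q = (LINT x|\<mu>. poly q (complex_of_real x))"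

text \<open>Only the moments of \<open>\<mu>\<close> enter the right-hand side, so measures with the
  same moments share the functional. This is how facts about \<open>\<mu>\<close> pass to a second
  measure with its moments.\<close>

lemma moment_functional_eq_sum:
  assumes "has_all_moments \<mu>"
  shows "moment_functional \<mu> q = (\<Sum>i\<le>degree q. coeff q i * complex_of_real (LINT x|\<mu>. x ^ i))"
proof -
  have *: "integrable \<mu> (\<lambda>x. x ^ i)" for i using assms unfolding has_all_moments_def by blast
  have "moment_functional \<mu> q = (LINT x|\<mu>. (\<Sum>i\<le>degree q. coeff q i * complex_of_real (x ^ i)))"
    by (simp add: moment_functional_def poly_altdef)
  also have "\<dots> = (\<Sum>i\<le>degree q. (LINT x|\<mu>. coeff q i * complex_of_real (x ^ i)))"
    using * by (intro Bochner_Integration.integral_sum integrable_mult_right integrable_of_real)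
  also have "\<dots> = (\<Sum>i\<le>degree q. coeff q i * complex_of_real (LINT x|\<mu>. x ^ i))"
    by (simp del: of_real_power)
  finally show ?thesis .
qed

lemma moment_functional_add:
  "has_all_moments \<mu> \<Longrightarrow> moment_functional \<mu> (p + q) = moment_functional \<mu> p + moment_functional \<mu> q"
  by (simp add: moment_functional_def integrable_complex_poly)

lemma moment_functional_diff:
  "has_all_moments \<mu> \<Longrightarrow> moment_functional \<mu> (p - q) = moment_functional \<mu> p - moment_functional \<mu> q"
  by (simp add: moment_functional_def integrable_complex_poly)

lemma moment_functional_smult: "moment_functional \<mu> (smult a q) = a * moment_functional \<mu> q"
  by (simp add: moment_functional_def)

lemma moment_functional_0: "moment_functional \<mu> 0 = 0"
  by (simp add: moment_functional_def)

lemma moment_functional_sum: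
  assumes "has_all_moments \<mu>" "finite A"
  shows "moment_functional \<mu> (\<Sum>i\<in>A. f i) = (\<Sum>i\<in>A. moment_functional \<mu> (f i))"
  using assms(2) by induction (simp_all add: moment_functional_add moment_functional_0 assms(1))

lemma poly_map_poly_complex_of_real:
  "poly (map_poly complex_of_real p) (complex_of_real x) = complex_of_real (poly p x)"
  by (simp add: poly_altdef coeff_map_poly degree_map_poly)

text \<open>The bracket \<open>1 + R * (\<Sum>k<n. g k * u k)\<close> grows at step \<open>n\<close>
  at most by the factor \<open>1 + R * (g n)\<^sup>2\<close>, which is at most
  \<open>exp (R * (g n)\<^sup>2)\<close>.\<close>

lemma discrete_gronwall:
  fixes u g :: "nat \<Rightarrow> real"
  assumes "\<And>n. u n \<ge> 0" "\<And>n. g n \<ge> 0" "R \<ge> 0"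
    and "\<And>n. u n \<le> g n * (1 + R * (\<Sum>k<n. g k * u k))"
  shows "u n \<le> g n * exp (R * (\<Sum>k<n. (g k)\<^sup>2))"
proof -
  have "1 + R * (\<Sum>k<n. g k * u k) \<le> exp (R * (\<Sum>k<n. (g k)\<^sup>2))" for n
  proof (induction n)
    case (Suc n)
    define s where "s = 1 + R * (\<Sum>k<n. g k * u k)"
    have s: "s \<ge> 0"
      unfolding s_def using assms(1-3) by (intro add_nonneg_nonneg mult_nonneg_nonneg sum_nonneg) auto
    have "1 + R * (\<Sum>k<Suc n. g k * u k) = s + R * (g n * u n)"
      by (simp add: s_def algebra_simps)
    also have "\<dots> \<le> s + R * (g n * (g n * s))"
      using assms unfolding s_def by (intro add_left_mono mult_left_mono) auto
    also have "\<dots> = (1 + R * (g n)\<^sup>2) * s" by (simp add: algebra_simps power2_eq_square)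
    also have "\<dots> \<le> exp (R * (g n)\<^sup>2) * exp (R * (\<Sum>k<n. (g k)\<^sup>2))"
      using s Suc.IH assms(3) by (intro mult_mono) (auto simp: s_def)
    also have "\<dots> = exp (R * (\<Sum>k<Suc n. (g k)\<^sup>2))"
      by (simp add: exp_add algebra_simps)
    finally show ?case .
  qed simp
  then have "g n * (1 + R * (\<Sum>k<n. g k * u k)) \<le> g n * exp (R * (\<Sum>k<n. (g k)\<^sup>2))"
    using assms(2) by (intro mult_left_mono)
  with assms(4)[of n] show ?thesis by linarith
qed

text \<open>As a locale, the setting can be interpreted a second time, for another measure with the
  same moments and the same polynomials.\<close>

locale orthonormal_polynomials =
  fixes \<mu> :: "real measure" and P :: "nat \<Rightarrow> real poly"
  assumes moments: "has_all_moments \<mu>"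
    and degree_P: "degree (P n) = n"
    and P_nonzero: "P n \<noteq> 0"
    and orthonormal: "(LINT x|\<mu>. poly (P n) x * poly (P m) x) = of_bool (m = n)"
begin

sublocale finite_measure \<mu>
  using has_all_moments_imp_finite_measure[OF moments] .

lemma sets_eq_borel [measurable_cong]: "sets \<mu> = sets borel"
  using moments by (simp add: has_all_moments_def)

abbreviation L :: "complex poly \<Rightarrow> complex" where "L \<equiv> moment_functional \<mu>"

abbreviation Pc :: "nat \<Rightarrow> complex poly" where "Pc n \<equiv> map_poly complex_of_real (P n)"

lemmas L_add = moment_functional_add[OF moments]
lemmas L_diff = moment_functional_diff[OF moments]
lemmas L_sum = moment_functional_sum[OF moments]
lemmas L_smult = moment_functional_smult[of \<mu>]

lemma degree_Pc: "degree (Pc n) = n"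
  by (simp add: degree_map_poly degree_P)

lemma L_Pc_mult_Pc: "L (Pc n * Pc m) = of_bool (m = n)"
proof -
  have "L (Pc n * Pc m) = (LINT x|\<mu>. complex_of_real (poly (P n) x * poly (P m) x))"
    by (simp add: moment_functional_def poly_map_poly_complex_of_real)
  also have "\<dots> = complex_of_real (of_bool (m = n))"
    by (simp only: integral_complex_of_real orthonormal)
  finally show ?thesis by simp
qed

text \<open>Subtracting a multiple of \<open>Pc n\<close> removes the coefficient of index
  \<open>n\<close>, and induction does the rest. The condition on coefficients means degree below
  \<open>n\<close> and, for \<open>n = 0\<close>, that \<open>q\<close> vanishes, which
  \<open>degree q < n\<close> could not express.\<close>

lemma orthonormal_span:
  assumes "\<And>i. i \<ge> n \<Longrightarrow> coeff q i = 0"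
  shows "\<exists>a. q = (\<Sum>k<n. smult (a k) (Pc k))"
  using assms
proof (induction n arbitrary: q)
  case 0
  then show ?case by (simp add: poly_eq_iff)
next
  case (Suc n)
  define b where "b = coeff q n / coeff (Pc n) n"
  have nz: "coeff (Pc n) n \<noteq> 0"
    using P_nonzero[of n] degree_P[of n] by (simp add: coeff_map_poly) (metis leading_coeff_0_iff)
  have "coeff (q - smult b (Pc n)) i = 0" if "i \<ge> n" for i
  proof (cases "i = n")
    case True
    with nz show ?thesis by (simp add: b_def)
  next
    case False
    with that show ?thesis using Suc.prems[of i] degree_Pc[of n] by (simp add: coeff_eq_0)
  qed
  then obtain a where "q - smult b (Pc n) = (\<Sum>k<n. smult (a k) (Pc k))" using Suc.IH by blast
  then have "q = (\<Sum>k<n. smult (a k) (Pc k)) + smult b (Pc n)" by (simp add: algebra_simps)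
  then have "q = (\<Sum>k<Suc n. smult ((a(n := b)) k) (Pc k))" by simp
  then show ?case by blast
qed

text \<open>Multiplying the expansion by \<open>Pc j\<close> and applying \<open>L\<close> isolates
  the coefficient \<open>a j\<close>; the pairing is bilinear, without conjugation.\<close>

lemma orthonormal_expansion:
  assumes "\<And>i. i \<ge> n \<Longrightarrow> coeff q i = 0"
  shows "q = (\<Sum>k<n. smult (L (q * Pc k)) (Pc k))"
proof -
  obtain a where a: "q = (\<Sum>k<n. smult (a k) (Pc k))" using orthonormal_span[OF assms] by blast
  have "L (q * Pc j) = a j" if "j < n" for j
  proof -
    have "L (q * Pc j) = (\<Sum>k<n. a k * L (Pc k * Pc j))"
      by (subst a) (simp add: sum_distrib_right L_sum L_smult)
    also have "\<dots> = (\<Sum>k<n. if k = j then a k else 0)"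
      by (intro sum.cong) (auto simp: L_Pc_mult_Pc)
    finally show ?thesis using that by simp
  qed
  then show ?thesis by (subst a) (intro sum.cong, auto)
qed

lemma L_Pc_mult_lower:
  assumes "\<And>i. i \<ge> n \<Longrightarrow> coeff q i = 0"
  shows "L (Pc n * q) = 0"
proof -
  obtain a where a: "q = (\<Sum>k<n. smult (a k) (Pc k))" using orthonormal_span[OF assms] by blast
  show ?thesis
    by (subst a) (simp add: sum_distrib_left L_sum L_smult L_Pc_mult_Pc)
qed

text \<open>The polynomial of the second kind at \<open>z\<close>:
  \<open>synthetic_div (Pc n) z\<close> is the divided difference of \<open>Pc n\<close> at
  \<open>x\<close> and \<open>z\<close>, as a polynomial in \<open>x\<close>. Written through
  \<open>L\<close>, its value depends on the measure only through the moments.\<close>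

definition second_kind :: "complex \<Rightarrow> nat \<Rightarrow> complex" where
  "second_kind z n = L (synthetic_div (Pc n) z)"

lemma coeff_synthetic_div_Pc:
  assumes "i \<ge> n" shows "coeff (synthetic_div (Pc n) z) i = 0"
proof (cases "n = 0")
  case True
  then have "synthetic_div (Pc n) z = 0" by (simp add: synthetic_div_eq_0_iff degree_Pc)
  then show ?thesis by simp
next
  case False
  with assms show ?thesis by (intro coeff_eq_0) (simp add: degree_synthetic_div degree_Pc)
qed

text \<open>With \<open>h n\<close> the divided difference of \<open>Pc n\<close>, split
  \<open>Pc k\<close> into \<open>(x - z) * h k\<close> and its value at \<open>z\<close>, then move
  the factor \<open>x - z\<close> over to \<open>h n\<close>. The term \<open>Pc n * h k\<close>
  that arises is killed by \<open>L\<close>, since \<open>h k\<close> has lower degree than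
  \<open>Pc n\<close>.\<close>

lemma L_synthetic_div_mult_Pc:
  assumes "k < n"
  shows "L (synthetic_div (Pc n) z * Pc k)
    = second_kind z n * poly (Pc k) z - poly (Pc n) z * second_kind z k"
proof -
  define h where "h = (\<lambda>n. synthetic_div (Pc n) z)"
  have dec: "Pc n = [:-z, 1:] * h n + [:poly (Pc n) z:]" for n
    unfolding h_def by (rule synthetic_div_correct'[symmetric])
  have "h n * Pc k = h n * ([:-z, 1:] * h k + [:poly (Pc k) z:])"
    by (subst dec) (rule refl)
  also have "\<dots> = smult (poly (Pc k) z) (h n) + ([:-z, 1:] * h n) * h k"
    by (simp add: algebra_simps)
  also have "[:-z, 1:] * h n = Pc n - [:poly (Pc n) z:]"
    using dec[of n] by (simp add: algebra_simps)
  also have "(Pc n - [:poly (Pc n) z:]) * h k = Pc n * h k - smult (poly (Pc n) z) (h k)"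
    by (simp add: algebra_simps)
  finally have "L (h n * Pc k) = poly (Pc k) z * L (h n) + (L (Pc n * h k) - poly (Pc n) z * L (h k))"
    by (simp add: L_add L_diff L_smult)
  moreover have "L (Pc n * h k) = 0"
    unfolding h_def using assms by (intro L_Pc_mult_lower coeff_synthetic_div_Pc) auto
  ultimately show ?thesis by (simp add: h_def second_kind_def algebra_simps)
qed

text \<open>The divided difference of \<open>Pc n\<close> at \<open>w\<close> and \<open>z\<close>
  has degree below \<open>n\<close>, so its orthonormal expansion involves only the
  \<open>Pc k\<close> with \<open>k < n\<close>. The result is a discrete Volterra equation for
  \<open>n \<mapsto> Pc n (w)\<close>.\<close>

lemma poly_Pc_recursion:
  "poly (Pc n) w = poly (Pc n) z + (w - z) *
     (\<Sum>k<n. (second_kind z n * poly (Pc k) z - poly (Pc n) z * second_kind z k) * poly (Pc k) w)"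
proof -
  have "poly (Pc n) w = poly ([:-z, 1:] * synthetic_div (Pc n) z + [:poly (Pc n) z:]) w"
    by (simp only: synthetic_div_correct')
  also have "\<dots> = poly (Pc n) z + (w - z) * poly (synthetic_div (Pc n) z) w"
    by (simp add: algebra_simps)
  also have "poly (synthetic_div (Pc n) z) w =
    (\<Sum>k<n. L (synthetic_div (Pc n) z * Pc k) * poly (Pc k) w)"
    by (subst orthonormal_expansion[of n]) (simp_all add: coeff_synthetic_div_Pc poly_sum)
  also have "\<dots> = (\<Sum>k<n. (second_kind z n * poly (Pc k) z - poly (Pc n) z * second_kind z k) * poly (Pc k) w)"
    by (intro sum.cong) (auto simp: L_synthetic_div_mult_Pc)
  finally show ?thesis .
qed

text \<open>Here \<open>g n\<close> is the Euclidean length of the pair of moduli of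
  \<open>Pc n (z)\<close> and \<open>second_kind z n\<close>. The Volterra kernel is bounded by
  \<open>g n * g k\<close>, so the Gronwall bound applies with
  \<open>R = norm (w - z)\<close>.\<close>

lemma norm_poly_Pc_le:
  fixes z :: complex
  defines "g \<equiv> \<lambda>n. sqrt ((norm (poly (Pc n) z))\<^sup>2 + (norm (second_kind z n))\<^sup>2)"
  shows "norm (poly (Pc n) w) \<le> g n * exp (norm (w - z) * (\<Sum>k<n. (g k)\<^sup>2))"
proof (rule discrete_gronwall)
  fix n
  let ?\<alpha> = "\<lambda>n. norm (poly (Pc n) z)" and ?\<beta> = "\<lambda>n. norm (second_kind z n)"
  have "norm (poly (Pc n) w) \<le> ?\<alpha> n + norm (w - z) *
     norm (\<Sum>k<n. (second_kind z n * poly (Pc k) z - poly (Pc n) z * second_kind z k) * poly (Pc k) w)"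
    by (subst poly_Pc_recursion[of n w z], rule order_trans[OF norm_triangle_ineq]) (simp add: norm_mult)
  also have "\<dots> \<le> g n + norm (w - z) * (\<Sum>k<n. g n * g k * norm (poly (Pc k) w))"
  proof (intro add_mono mult_left_mono sum_norm_le)
    show "?\<alpha> n \<le> g n" unfolding g_def by (rule real_sqrt_sum_squares_ge1)
  next
    fix k
    have "norm (second_kind z n * poly (Pc k) z - poly (Pc n) z * second_kind z k)
        \<le> ?\<beta> n * ?\<alpha> k + ?\<alpha> n * ?\<beta> k"
      by (rule order_trans[OF norm_triangle_ineq4]) (simp add: norm_mult)
    \<comment> \<open>The coordinates of the second vector are swapped to match the cross terms; its
      length is still \<open>g k\<close>.\<close>
    also have "\<dots> = inner (?\<alpha> n, ?\<beta> n) (?\<beta> k, ?\<alpha> k)" by (simp add: algebra_simps)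
    also have "\<dots> \<le> norm (?\<alpha> n, ?\<beta> n) * norm (?\<beta> k, ?\<alpha> k)" by (rule norm_cauchy_schwarz)
    also have "\<dots> = g n * g k" by (simp add: g_def norm_Pair add.commute)
    finally show "norm ((second_kind z n * poly (Pc k) z - poly (Pc n) z * second_kind z k) * poly (Pc k) w)
       \<le> g n * g k * norm (poly (Pc k) w)"
      by (simp add: norm_mult mult_right_mono)
  qed auto
  also have "\<dots> = g n * (1 + norm (w - z) * (\<Sum>k<n. g k * norm (poly (Pc k) w)))"
    by (simp add: algebra_simps sum_distrib_left)
  finally show "norm (poly (Pc n) w) \<le> g n * (1 + norm (w - z) * (\<Sum>k<n. g k * norm (poly (Pc k) w)))" .
qed (auto simp: g_def)

end

subsection \<open>Indeterminate measures\<close>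

context orthonormal_polynomials begin

text \<open>Bilinear rather than sesquilinear, because the product of two values of \<open>G\<close>
  carries no conjugate. Norms are obtained by choosing \<open>b n = cnj (a n)\<close>.\<close>

lemma
  assumes "finite A"
  shows integrable_sum_mult_sum:
      "integrable \<mu> (\<lambda>x. (\<Sum>n\<in>A. a n * poly (Pc n) (of_real x)) * (\<Sum>n\<in>A. b n * poly (Pc n) (of_real x)))"
    and integral_sum_mult_sum:
      "(LINT x|\<mu>. (\<Sum>n\<in>A. a n * poly (Pc n) (of_real x)) * (\<Sum>n\<in>A. b n * poly (Pc n) (of_real x)))
         = (\<Sum>n\<in>A. a n * b n)"
proof -
  have eq: "(\<Sum>n\<in>A. a n * poly (Pc n) (of_real x)) * (\<Sum>n\<in>A. b n * poly (Pc n) (of_real x))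
    = poly (\<Sum>m\<in>A. \<Sum>n\<in>A. smult (a m * b n) (Pc m * Pc n)) (complex_of_real x)" for x
    by (simp add: sum_product poly_sum algebra_simps)
  show "integrable \<mu> (\<lambda>x. (\<Sum>n\<in>A. a n * poly (Pc n) (of_real x)) * (\<Sum>n\<in>A. b n * poly (Pc n) (of_real x)))"
    unfolding eq by (intro integrable_complex_poly moments)
  have "(LINT x|\<mu>. (\<Sum>n\<in>A. a n * poly (Pc n) (of_real x)) * (\<Sum>n\<in>A. b n * poly (Pc n) (of_real x)))
    = (\<Sum>m\<in>A. \<Sum>n\<in>A. a m * b n * L (Pc m * Pc n))"
    unfolding eq by (simp add: L_sum L_smult assms flip: moment_functional_def)
  also have "\<dots> = (\<Sum>m\<in>A. \<Sum>n\<in>A. if m = n then a m * b n else 0)"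
    by (intro sum.cong) (auto simp: L_Pc_mult_Pc)
  finally show "(LINT x|\<mu>. (\<Sum>n\<in>A. a n * poly (Pc n) (of_real x)) * (\<Sum>n\<in>A. b n * poly (Pc n) (of_real x)))
         = (\<Sum>n\<in>A. a n * b n)"
    using assms by simp
qed

text \<open>Expand the nonnegative integral of \<open>(norm (f x - s x))\<^sup>2\<close>, where
  \<open>s\<close> is the Fourier partial sum of \<open>f\<close>. Boundedness of \<open>f\<close>
  on a finite measure makes all the integrals involved exist.\<close>

lemma bessel_inequality:
  fixes f :: "real \<Rightarrow> complex"
  assumes f [measurable]: "f \<in> borel_measurable borel" and bnd: "\<And>x. norm (f x) \<le> B"
  shows "(\<Sum>n<N. (norm (LINT x|\<mu>. f x * poly (Pc n) (of_real x)))\<^sup>2) \<le> (LINT x|\<mu>. (norm (f x))\<^sup>2)"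
proof -
  define a where "a = (\<lambda>n. LINT x|\<mu>. f x * poly (Pc n) (of_real x))"
  define s where "s = (\<lambda>x::real. \<Sum>n<N. a n * poly (Pc n) (of_real x))"
  have int_f2: "integrable \<mu> (\<lambda>x. complex_of_real ((norm (f x))\<^sup>2))"
    by (rule integrable_const_bound[where B = "B\<^sup>2"])
       (use bnd in \<open>auto simp: norm_power intro!: power_mono\<close>)
  have int_fp: "integrable \<mu> (\<lambda>x. f x * poly q (of_real x))" for q
  proof (rule Bochner_Integration.integrable_bound)
    show "integrable \<mu> (\<lambda>x. B * norm (poly q (complex_of_real x)))"
      by (intro integrable_mult_right integrable_norm integrable_complex_poly moments)
    show "AE x in \<mu>. norm (f x * poly q (of_real x)) \<le> norm (B * norm (poly q (complex_of_real x)))"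
      using order_trans[OF bnd abs_ge_self] by (auto simp: norm_mult abs_mult intro!: AE_I2 mult_right_mono)
    show "(\<lambda>x. f x * poly q (of_real x)) \<in> borel_measurable \<mu>"
      by (intro borel_measurable_times f[THEN measurable_compose_rev] )
         (auto intro: borel_measurable_integrable integrable_complex_poly moments)
  qed
  \<comment> \<open>The \<open>Pc n\<close> are real on the real line, so conjugation affects only
    the coefficients.\<close>
  have cnj_s: "cnj (s x) = (\<Sum>n<N. cnj (a n) * poly (Pc n) (of_real x))" for x
    by (simp add: s_def poly_map_poly_complex_of_real)
  have int_fs: "integrable \<mu> (\<lambda>x. f x * cnj (s x))"
    and fs: "(LINT x|\<mu>. f x * cnj (s x)) = (\<Sum>n<N. cnj (a n) * a n)"
  proof -
    have eq: "f x * cnj (s x) = (\<Sum>n<N. cnj (a n) * (f x * poly (Pc n) (of_real x)))" for x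
      by (simp add: cnj_s sum_distrib_left algebra_simps)
    show "integrable \<mu> (\<lambda>x. f x * cnj (s x))"
      unfolding eq by (intro Bochner_Integration.integrable_sum integrable_mult_right int_fp)
    show "(LINT x|\<mu>. f x * cnj (s x)) = (\<Sum>n<N. cnj (a n) * a n)"
      unfolding eq by (subst Bochner_Integration.integral_sum)
        (auto simp: a_def intro: int_fp integrable_mult_right)
  qed
  have int_ss: "integrable \<mu> (\<lambda>x. s x * cnj (s x))"
    and ss: "(LINT x|\<mu>. s x * cnj (s x)) = (\<Sum>n<N. cnj (a n) * a n)"
    using integrable_sum_mult_sum[of "{..<N}" a "\<lambda>n. cnj (a n)"]
      integral_sum_mult_sum[of "{..<N}" a "\<lambda>n. cnj (a n)"]
    unfolding s_def by (simp_all add: poly_map_poly_complex_of_real mult.commute)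
  have sq: "(norm (f x - s x))\<^sup>2 = (norm (f x))\<^sup>2 - 2 * Re (f x * cnj (s x)) + Re (s x * cnj (s x))" for x
    unfolding cmod_power2 by (simp add: algebra_simps power2_eq_square)
  have i: "integrable \<mu> (\<lambda>x. (norm (f x))\<^sup>2)" "integrable \<mu> (\<lambda>x. 2 * Re (f x * cnj (s x)))"
    "integrable \<mu> (\<lambda>x. Re (s x * cnj (s x)))"
    using int_f2 int_fs int_ss
    by (auto simp only: complex_of_real_integrable_eq intro: integrable_Re integrable_mult_right)
  have "0 \<le> (LINT x|\<mu>. (norm (f x - s x))\<^sup>2)" by simp
  also have "\<dots> = (LINT x|\<mu>. (norm (f x))\<^sup>2) - 2 * Re (\<Sum>n<N. cnj (a n) * a n) + Re (\<Sum>n<N. cnj (a n) * a n)"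
    unfolding sq Bochner_Integration.integral_add[OF Bochner_Integration.integrable_diff[OF i(1,2)] i(3)]
      Bochner_Integration.integral_diff[OF i(1,2)]
    by (simp only: integral_mult_right_zero integral_Re[OF int_fs] integral_Re[OF int_ss] fs ss)
  also have "Re (\<Sum>n<N. cnj (a n) * a n) = (\<Sum>n<N. (norm (a n))\<^sup>2)"
    unfolding cmod_power2 by (simp add: power2_eq_square)
  finally show ?thesis unfolding a_def by simp
qed

text \<open>Dividing \<open>Pc n\<close> by \<open>x - z\<close> leaves the divided difference,
  whose integral is \<open>second_kind z n\<close>, and the remainder \<open>Pc n (z)\<close> times
  the resolvent.\<close>

lemma integral_Pc_resolvent:
  assumes "Im z \<noteq> 0"
  shows "(LINT x|\<mu>. 1 / (complex_of_real x - z) * poly (Pc n) (of_real x))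
    = second_kind z n + stieltjes \<mu> z * poly (Pc n) z"
proof -
  let ?h = "synthetic_div (Pc n) z"
  have "1 / (complex_of_real x - z) * poly (Pc n) (of_real x)
    = poly ?h (of_real x) + 1 / (complex_of_real x - z) * poly (Pc n) z" for x
  proof -
    have nz: "complex_of_real x - z \<noteq> 0" using assms by (auto simp: complex_eq_iff)
    have "poly (Pc n) (of_real x) = poly ([:-z, 1:] * ?h + [:poly (Pc n) z:]) (of_real x)"
      by (simp only: synthetic_div_correct')
    then have "poly (Pc n) (of_real x) = (of_real x - z) * poly ?h (of_real x) + poly (Pc n) z"
      by (simp add: algebra_simps)
    then show ?thesis using nz by (simp add: field_simps)
  qed
  note eq = this
  have i: "integrable \<mu> (\<lambda>x. 1 / (complex_of_real x - z))"
    by (rule integrable_resolvent[OF finite_measure_axioms sets_eq_borel assms])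
  show ?thesis
    unfolding eq
    by (subst Bochner_Integration.integral_add[OF integrable_complex_poly[OF moments] integrable_mult_left[OF i]],
        subst Bochner_Integration.integral_mult_left[OF i])
      (simp add: second_kind_def moment_functional_def stieltjes_def)
qed

text \<open>Bessel's inequality for the resolvent, which is bounded on the real line. In the
  resulting sequence only \<open>stieltjes \<mu> z\<close> can distinguish measures with equal
  moments.\<close>

lemma summable_second_kind_plus:
  assumes "Im z \<noteq> 0"
  shows "summable (\<lambda>n. (norm (second_kind z n + stieltjes \<mu> z * poly (Pc n) z))\<^sup>2)"
proof (rule summableI_nonneg_bounded)
  fix N
  have "(\<Sum>n<N. (norm (LINT x|\<mu>. 1 / (complex_of_real x - z) * poly (Pc n) (of_real x)))\<^sup>2)
     \<le> (LINT x|\<mu>. (norm (1 / (complex_of_real x - z)))\<^sup>2)"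
    by (rule bessel_inequality[OF _ norm_resolvent_le[OF assms]]) measurable
  then show "(\<Sum>n<N. (norm (second_kind z n + stieltjes \<mu> z * poly (Pc n) z))\<^sup>2)
     \<le> (LINT x|\<mu>. (norm (1 / (complex_of_real x - z)))\<^sup>2)"
    by (simp only: integral_Pc_resolvent[OF assms])
qed simp

end

section \<open>Square summable sequences and local boundedness in the indeterminate case\<close>

lemma norm_add_power2_le:
  fixes a b :: "'a::real_normed_vector"
  shows "(norm (a + b))\<^sup>2 \<le> 2 * (norm a)\<^sup>2 + 2 * (norm b)\<^sup>2"
proof -
  have "(norm (a + b))\<^sup>2 \<le> (norm a + norm b)\<^sup>2"
    by (intro power_mono norm_triangle_ineq) auto
  also have "\<dots> \<le> 2 * (norm a)\<^sup>2 + 2 * (norm b)\<^sup>2"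
    using sum_squares_bound[of "norm a" "norm b"] by (simp add: power2_sum)
  finally show ?thesis .
qed

lemma summable_norm_power2_add:
  fixes f g :: "nat \<Rightarrow> 'a::real_normed_vector"
  assumes "summable (\<lambda>n. (norm (f n))\<^sup>2)" "summable (\<lambda>n. (norm (g n))\<^sup>2)"
  shows "summable (\<lambda>n. (norm (f n + g n))\<^sup>2)"
proof (rule summable_comparison_test')
  show "summable (\<lambda>n. 2 * (norm (f n))\<^sup>2 + 2 * (norm (g n))\<^sup>2)"
    using assms by (intro summable_add summable_mult)
  show "norm ((norm (f n + g n))\<^sup>2) \<le> 2 * (norm (f n))\<^sup>2 + 2 * (norm (g n))\<^sup>2" for n
    using norm_add_power2_le[of "f n" "g n"] by simp
qed

lemma summable_norm_power2_cmult:
  fixes f :: "nat \<Rightarrow> complex"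
  assumes "summable (\<lambda>n. (norm (f n))\<^sup>2)"
  shows "summable (\<lambda>n. (norm (c * f n))\<^sup>2)"
  using summable_mult[OF assms, of "(norm c)\<^sup>2"] by (simp add: norm_mult power_mult_distrib)

lemma (in orthonormal_polynomials) locally_bounded_if_indeterminate:
  assumes "indeterminate \<mu>"
  shows "\<exists>B. \<forall>n z. norm z \<le> R \<longrightarrow> norm (poly (Pc n) z) \<le> B"
proof -
  obtain \<nu> where \<nu>: "has_all_moments \<nu>" "\<nu> \<noteq> \<mu>" "\<And>n::nat. (LINT x|\<nu>. x ^ n) = (LINT x|\<mu>. x ^ n)"
    using assms unfolding indeterminate_def by blast
  have L\<nu>: "moment_functional \<nu> = L"
    using \<nu>(1,3) moments by (auto simp: fun_eq_iff moment_functional_eq_sum)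
  \<comment> \<open>Orthonormality is a condition on moments, so the same polynomials serve
    \<open>\<nu>\<close>.\<close>
  interpret \<nu>: orthonormal_polynomials \<nu> P
  proof
    fix m n
    have "complex_of_real (LINT x|\<nu>. poly (P n) x * poly (P m) x) = moment_functional \<nu> (Pc n * Pc m)"
      by (simp add: moment_functional_def poly_map_poly_complex_of_real flip: integral_complex_of_real)
    also have "\<dots> = complex_of_real (of_bool (m = n))" by (simp add: L\<nu> L_Pc_mult_Pc)
    finally show "(LINT x|\<nu>. poly (P n) x * poly (P m) x) = of_bool (m = n)"
      by (simp only: of_real_eq_iff)
  qed (use \<nu>(1) degree_P P_nonzero in auto)
  have second_kind: "\<nu>.second_kind = second_kind"
    by (simp add: fun_eq_iff second_kind_def \<nu>.second_kind_def L\<nu>)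
  have "measure \<mu> UNIV = measure \<nu> UNIV"
    using \<nu>(3)[of 0] sets_eq_imp_space_eq[OF sets_eq_borel] sets_eq_imp_space_eq[OF \<nu>.sets_eq_borel]
    by simp
  then obtain z where z: "Im z > 0" "stieltjes \<mu> z \<noteq> stieltjes \<nu> z"
    using stieltjes_inject[OF finite_measure_axioms sets_eq_borel \<nu>.finite_measure_axioms \<nu>.sets_eq_borel]
      \<nu>(2) by metis
  let ?w = "stieltjes \<mu> z" and ?v = "stieltjes \<nu> z"
  have 1: "summable (\<lambda>n. (norm (second_kind z n + ?w * poly (Pc n) z))\<^sup>2)"
    and 2: "summable (\<lambda>n. (norm (second_kind z n + ?v * poly (Pc n) z))\<^sup>2)"
    using summable_second_kind_plus[of z] \<nu>.summable_second_kind_plus[of z] z(1)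
    by (auto simp: second_kind)
  \<comment> \<open>The difference of the two square summable sequences is \<open>?w - ?v\<close>
    times \<open>poly (Pc n) z\<close>, and \<open>?w - ?v\<close> is nonzero by the choice of
    \<open>z\<close>.\<close>
  have "summable (\<lambda>n. (norm (1 / (?w - ?v) * ((second_kind z n + ?w * poly (Pc n) z)
       + (-1) * (second_kind z n + ?v * poly (Pc n) z))))\<^sup>2)"
    by (intro summable_norm_power2_cmult summable_norm_power2_add 1 2)
  also have "(\<lambda>n. 1 / (?w - ?v) * ((second_kind z n + ?w * poly (Pc n) z)
       + (-1) * (second_kind z n + ?v * poly (Pc n) z))) = (\<lambda>n. poly (Pc n) z)"
    using z(2) by (auto simp: fun_eq_iff field_simps)
  finally have sP: "summable (\<lambda>n. (norm (poly (Pc n) z))\<^sup>2)" .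
  have "summable (\<lambda>n. (norm ((second_kind z n + ?w * poly (Pc n) z) + (- ?w) * poly (Pc n) z))\<^sup>2)"
    by (intro summable_norm_power2_cmult summable_norm_power2_add 1 sP)
  then have sQ: "summable (\<lambda>n. (norm (second_kind z n))\<^sup>2)" by simp
  define g where "g = (\<lambda>n. sqrt ((norm (poly (Pc n) z))\<^sup>2 + (norm (second_kind z n))\<^sup>2))"
  have g2: "summable (\<lambda>n. (g n)\<^sup>2)"
    using summable_add[OF sP sQ] by (simp add: g_def)
  define \<Gamma> where "\<Gamma> = (\<Sum>n. (g n)\<^sup>2)"
  have \<Gamma>: "(\<Sum>k<n. (g k)\<^sup>2) \<le> \<Gamma>" for n
    unfolding \<Gamma>_def by (rule sum_le_suminf[OF g2]) auto
  have g_le: "g n \<le> sqrt \<Gamma>" for n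
  proof (rule real_le_rsqrt)
    have "(g n)\<^sup>2 \<le> (\<Sum>k<Suc n. (g k)\<^sup>2)" by (simp add: sum_nonneg)
    then show "(g n)\<^sup>2 \<le> \<Gamma>" using \<Gamma>[of "Suc n"] by linarith
  qed
  \<comment> \<open>In the Gronwall bound both the factor \<open>g n\<close> and the sum in the
    exponent are controlled by \<open>\<Gamma>\<close>, uniformly in \<open>n\<close>;
    \<open>w\<close> enters only through \<open>norm (w - z)\<close>.\<close>
  have "norm (poly (Pc n) w) \<le> sqrt \<Gamma> * exp ((R + norm z) * \<Gamma>)" if "norm w \<le> R" for n w
  proof -
    have "norm (poly (Pc n) w) \<le> g n * exp (norm (w - z) * (\<Sum>k<n. (g k)\<^sup>2))"
      unfolding g_def by (rule norm_poly_Pc_le)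
    also have "\<dots> \<le> sqrt \<Gamma> * exp ((R + norm z) * \<Gamma>)"
    proof (intro mult_mono iffD2[OF exp_le_cancel_iff] g_le \<Gamma>)
      show "norm (w - z) \<le> R + norm z" using norm_triangle_ineq4[of w z] that by linarith
      show "0 \<le> R + norm z" using that norm_ge_zero[of w] norm_ge_zero[of z] by linarith
      show "0 \<le> sqrt \<Gamma>" using \<Gamma>[of 0] by simp
    qed (auto intro: sum_nonneg)
    finally show ?thesis .
  qed
  then show ?thesis by blast
qed

subsection \<open>Series in \<open>L\<^sup>2\<close>\<close>

text \<open>This is the form in which Fatou's lemma delivers square integrability.\<close>

lemma square_integrable_iff_nn_integral:
  "square_integrable M f \<longleftrightarrow> f \<in> borel_measurable M \<and> (\<integral>\<^sup>+x. ennreal ((norm (f x))\<^sup>2) \<partial>M) < \<infinity>"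
  by (auto simp: square_integrable_def integrable_iff_bounded)

lemma square_integrable_add:
  assumes "square_integrable M f" "square_integrable M g"
  shows "square_integrable M (\<lambda>x. f x + g x)"
  unfolding square_integrable_def
proof
  have [measurable]: "f \<in> borel_measurable M" "g \<in> borel_measurable M"
    using assms by (auto simp: square_integrable_def)
  show "(\<lambda>x. f x + g x) \<in> borel_measurable M" by measurable
  show "integrable M (\<lambda>x. (norm (f x + g x))\<^sup>2)"
  proof (rule Bochner_Integration.integrable_bound)
    show "integrable M (\<lambda>x. 2 * (norm (f x))\<^sup>2 + 2 * (norm (g x))\<^sup>2)"
      using assms by (intro Bochner_Integration.integrable_add integrable_mult_right)
        (auto simp: square_integrable_def)
    show "AE x in M. norm ((norm (f x + g x))\<^sup>2) \<le> norm (2 * (norm (f x))\<^sup>2 + 2 * (norm (g x))\<^sup>2)"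
      using norm_add_power2_le by (intro AE_I2) auto
  qed measurable
qed

lemma square_integrable_uminus:
  "square_integrable M f \<Longrightarrow> square_integrable M (\<lambda>x. - f x)"
  by (auto simp: square_integrable_def)

lemma square_integrable_diff:
  assumes "square_integrable M f" "square_integrable M g"
  shows "square_integrable M (\<lambda>x. f x - g x)"
  using square_integrable_add[OF assms(1) square_integrable_uminus[OF assms(2)]] by simp

lemma integrable_mult_square_integrable:
  assumes "square_integrable M f" "square_integrable M g"
  shows "integrable M (\<lambda>x. f x * g x)"
proof (rule Bochner_Integration.integrable_bound)
  have [measurable]: "f \<in> borel_measurable M" "g \<in> borel_measurable M"
    using assms by (auto simp: square_integrable_def)
  show "(\<lambda>x. f x * g x) \<in> borel_measurable M" by measurable
  show "integrable M (\<lambda>x. (norm (f x))\<^sup>2 + (norm (g x))\<^sup>2)"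
    using assms by (intro Bochner_Integration.integrable_add) (auto simp: square_integrable_def)
  have "norm (f x * g x) \<le> (norm (f x))\<^sup>2 + (norm (g x))\<^sup>2" for x
  proof -
    have "2 * (norm (f x) * norm (g x)) \<le> (norm (f x))\<^sup>2 + (norm (g x))\<^sup>2"
      using sum_squares_bound[of "norm (f x)" "norm (g x)"] by simp
    moreover have "0 \<le> norm (f x) * norm (g x)" by simp
    ultimately show ?thesis unfolding norm_mult by linarith
  qed
  then show "AE x in M. norm (f x * g x) \<le> norm ((norm (f x))\<^sup>2 + (norm (g x))\<^sup>2)"
    by (auto intro: order_trans)
qed

text \<open>Cauchy-Schwarz, obtained from its version for nonnegative integrals; square
  integrability permits the return to real integrals.\<close>

lemma norm_integral_mult_le:
  assumes "square_integrable M f" "square_integrable M g"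
  shows "norm (LINT x|M. f x * g x) \<le> norm_L2 M f * norm_L2 M g"
proof -
  have [measurable]: "f \<in> borel_measurable M" "g \<in> borel_measurable M"
    using assms by (auto simp: square_integrable_def)
  have i: "integrable M (\<lambda>x. norm (f x * g x))"
    by (intro integrable_norm integrable_mult_square_integrable assms)
  have "ennreal ((LINT x|M. norm (f x * g x))\<^sup>2) = (\<integral>\<^sup>+x. ennreal (norm (f x)) * ennreal (norm (g x)) \<partial>M)\<^sup>2"
    using nn_integral_eq_integral[OF i] by (simp add: norm_mult ennreal_mult ennreal_power)
  also have "\<dots> \<le> (\<integral>\<^sup>+x. (ennreal (norm (f x)))\<^sup>2 \<partial>M) * (\<integral>\<^sup>+x. (ennreal (norm (g x)))\<^sup>2 \<partial>M)"
    by (rule Cauchy_Schwarz_nn_integral) measurable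
  also have "\<dots> = ennreal ((LINT x|M. (norm (f x))\<^sup>2) * (LINT x|M. (norm (g x))\<^sup>2))"
    using assms unfolding square_integrable_def
    by (simp add: ennreal_power nn_integral_eq_integral ennreal_mult)
  finally have "(LINT x|M. norm (f x * g x))\<^sup>2 \<le> (LINT x|M. (norm (f x))\<^sup>2) * (LINT x|M. (norm (g x))\<^sup>2)"
    by (subst (asm) ennreal_le_iff) auto
  then have "(LINT x|M. norm (f x * g x)) \<le> norm_L2 M f * norm_L2 M g"
    unfolding norm_L2_def real_sqrt_mult[symmetric] by (rule real_le_rsqrt)
  then show ?thesis by (rule order_trans[OF integral_norm_bound])
qed

lemma converges_in_L2_integral_mult:
  assumes "converges_in_L2 M F f" "converges_in_L2 M G g"
  shows "(\<lambda>n. LINT x|M. F n x * G n x) \<longlonglongrightarrow> (LINT x|M. f x * g x)"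
proof -
  have sq: "square_integrable M (F n)" "square_integrable M (G n)" "square_integrable M f" "square_integrable M g"
    and lim: "(\<lambda>n. norm_L2 M (\<lambda>x. F n x - f x)) \<longlonglongrightarrow> 0" "(\<lambda>n. norm_L2 M (\<lambda>x. G n x - g x)) \<longlonglongrightarrow> 0" for n
    using assms by (auto simp: converges_in_L2_def)
  have "(\<lambda>n. (LINT x|M. F n x * G n x) - (LINT x|M. f x * g x)) \<longlonglongrightarrow> 0"
  proof (rule Lim_null_comparison)
    show "\<forall>\<^sub>F n in sequentially. norm ((LINT x|M. F n x * G n x) - (LINT x|M. f x * g x)) \<le>
      norm_L2 M (\<lambda>x. F n x - f x) * norm_L2 M (\<lambda>x. G n x - g x) +
      norm_L2 M (\<lambda>x. F n x - f x) * norm_L2 M g + norm_L2 M f * norm_L2 M (\<lambda>x. G n x - g x)"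
    proof (rule always_eventually, rule allI)
      fix n
      note d = square_integrable_diff[OF sq(1,3), of n] square_integrable_diff[OF sq(2,4), of n]
      note i = integrable_mult_square_integrable[OF d] integrable_mult_square_integrable[OF d(1) sq(4)]
        integrable_mult_square_integrable[OF sq(3) d(2)]
      have "(LINT x|M. F n x * G n x) - (LINT x|M. f x * g x) = (LINT x|M. F n x * G n x - f x * g x)"
        by (intro Bochner_Integration.integral_diff[symmetric] integrable_mult_square_integrable sq)
      \<comment> \<open>Every summand now contains a difference that is small in
        \<open>L\<^sup>2\<close>, so Cauchy-Schwarz applies to each.\<close>
      also have "\<dots> = (LINT x|M. (F n x - f x) * (G n x - g x) + (F n x - f x) * g x + f x * (G n x - g x))"
        by (intro Bochner_Integration.integral_cong refl) (simp add: algebra_simps)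
      also have "\<dots> = (LINT x|M. (F n x - f x) * (G n x - g x)) + (LINT x|M. (F n x - f x) * g x)
          + (LINT x|M. f x * (G n x - g x))"
        using Bochner_Integration.integral_add[OF Bochner_Integration.integrable_add[OF i(1,2)] i(3)]
          Bochner_Integration.integral_add[OF i(1,2)] by (simp only:)
      finally show "norm ((LINT x|M. F n x * G n x) - (LINT x|M. f x * g x)) \<le>
        norm_L2 M (\<lambda>x. F n x - f x) * norm_L2 M (\<lambda>x. G n x - g x) +
        norm_L2 M (\<lambda>x. F n x - f x) * norm_L2 M g + norm_L2 M f * norm_L2 M (\<lambda>x. G n x - g x)"
        by (simp only:) (intro norm_triangle_mono norm_integral_mult_le d sq)
    qed
    show "(\<lambda>n. norm_L2 M (\<lambda>x. F n x - f x) * norm_L2 M (\<lambda>x. G n x - g x) +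
      norm_L2 M (\<lambda>x. F n x - f x) * norm_L2 M g + norm_L2 M f * norm_L2 M (\<lambda>x. G n x - g x)) \<longlonglongrightarrow> 0"
      by (rule tendsto_eq_intros lim refl)+ simp
  qed
  then show ?thesis by (rule LIM_zero_cancel)
qed

section \<open>Orthonormal series with absolutely summable coefficients\<close>

context orthonormal_polynomials begin

lemma measurable_poly_of_real [measurable]:
  "(\<lambda>x. poly q (complex_of_real x)) \<in> borel_measurable borel"
  by (intro borel_measurable_continuous_onI continuous_intros)

lemma
  assumes "finite A"
  shows square_integrable_sum: "square_integrable \<mu> (\<lambda>x. \<Sum>n\<in>A. a n * poly (Pc n) (of_real x))"
    and integral_norm_sum_power2:
      "(LINT x|\<mu>. (norm (\<Sum>n\<in>A. a n * poly (Pc n) (of_real x)))\<^sup>2) = (\<Sum>n\<in>A. (norm (a n))\<^sup>2)"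
proof -
  let ?s = "\<lambda>a x. \<Sum>n\<in>A. a n * poly (Pc n) (complex_of_real x)"
  have eq: "complex_of_real ((norm (?s a x))\<^sup>2) = ?s a x * ?s (\<lambda>n. cnj (a n)) x" for x
    by (subst complex_norm_square) (simp add: poly_map_poly_complex_of_real)
  have i: "integrable \<mu> (\<lambda>x. complex_of_real ((norm (?s a x))\<^sup>2))"
    unfolding eq by (rule integrable_sum_mult_sum[OF assms])
  have "?s a \<in> borel_measurable \<mu>" by measurable
  with i show "square_integrable \<mu> (?s a)"
    by (simp only: square_integrable_def complex_of_real_integrable_eq simp_thms)
  have "complex_of_real (LINT x|\<mu>. (norm (?s a x))\<^sup>2) = (\<Sum>n\<in>A. a n * cnj (a n))"
    unfolding integral_complex_of_real[symmetric] eq by (rule integral_sum_mult_sum[OF assms])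
  also have "\<dots> = complex_of_real (\<Sum>n\<in>A. (norm (a n))\<^sup>2)"
    by (simp add: complex_norm_square del: of_real_power)
  finally show "(LINT x|\<mu>. (norm (?s a x))\<^sup>2) = (\<Sum>n\<in>A. (norm (a n))\<^sup>2)"
    by (simp only: of_real_eq_iff)
qed

text \<open>From \<open>t \<le> 1 + t\<^sup>2\<close> and normalization. What matters is that the
  bound does not depend on \<open>n\<close>.\<close>

lemma integral_norm_Pc_le: "(LINT x|\<mu>. norm (poly (Pc n) (of_real x))) \<le> measure \<mu> (space \<mu>) + 1"
proof -
  have sq: "integrable \<mu> (\<lambda>x. (norm (poly (Pc n) (of_real x)))\<^sup>2)"
    and one: "(LINT x|\<mu>. (norm (poly (Pc n) (of_real x)))\<^sup>2) = 1"
    using square_integrable_sum[of "{n}" "\<lambda>_. 1"] integral_norm_sum_power2[of "{n}" "\<lambda>_. 1"]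
    by (auto simp: square_integrable_def)
  have "(LINT x|\<mu>. norm (poly (Pc n) (of_real x))) \<le> (LINT x|\<mu>. 1 + (norm (poly (Pc n) (of_real x)))\<^sup>2)"
  proof (intro integral_mono integrable_norm integrable_complex_poly moments
      Bochner_Integration.integrable_add integrable_const sq)
    fix x show "norm (poly (Pc n) (of_real x)) \<le> 1 + (norm (poly (Pc n) (complex_of_real x)))\<^sup>2"
      using sum_squares_bound[of "norm (poly (Pc n) (of_real x))" 1] norm_ge_zero[of "poly (Pc n) (of_real x)"]
      unfolding power_one mult_1_right by linarith
  qed
  also have "\<dots> = measure \<mu> (space \<mu>) + 1"
    using sq by (simp add: one)
  finally show ?thesis .
qed

text \<open>Sum and integral of the nonnegative terms may be exchanged, and the
  \<open>L\<^sup>1\<close> norms of the \<open>Pc n\<close> are bounded. Hence the sum of the moduli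
  has a finite integral and is finite almost everywhere.\<close>

lemma AE_summable:
  assumes "summable (\<lambda>n. norm (a n))"
  shows "AE x in \<mu>. summable (\<lambda>n. norm (a n * poly (Pc n) (of_real x)))"
proof -
  let ?m = "measure \<mu> (space \<mu>) + 1"
  have "(\<integral>\<^sup>+x. (\<Sum>n. ennreal (norm (a n * poly (Pc n) (of_real x)))) \<partial>\<mu>)
     = (\<Sum>n. \<integral>\<^sup>+x. ennreal (norm (a n * poly (Pc n) (of_real x))) \<partial>\<mu>)"
    by (rule nn_integral_suminf) measurable
  also have "\<dots> = (\<Sum>n. ennreal (norm (a n) * (LINT x|\<mu>. norm (poly (Pc n) (of_real x)))))"
    by (subst nn_integral_eq_integral)
       (auto simp: norm_mult intro!: integrable_mult_right integrable_norm integrable_complex_poly moments)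
  also have "\<dots> \<le> (\<Sum>n. ennreal (norm (a n) * ?m))"
    by (intro suminf_le ennreal_leI mult_left_mono integral_norm_Pc_le) auto
  also have "\<dots> = ennreal (\<Sum>n. norm (a n) * ?m)"
    by (intro suminf_ennreal2 summable_mult2 assms) auto
  also have "\<dots> < \<infinity>" by simp
  finally have "AE x in \<mu>. (\<Sum>n. ennreal (norm (a n * poly (Pc n) (of_real x)))) \<noteq> \<infinity>"
    by (intro nn_integral_PInf_AE) auto
  then show ?thesis
    by eventually_elim (rule summable_suminf_not_top, auto)
qed

text \<open>The limit is identified as the pointwise sum itself; on the null set where the series
  may diverge, the value of the infinite sum is irrelevant.\<close>

lemma converges_in_L2_series:
  assumes "summable (\<lambda>n. norm (a n))"
  shows "converges_in_L2 \<mu> (\<lambda>k x. \<Sum>n<k. a n * poly (Pc n) (of_real x))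
           (\<lambda>x. \<Sum>n. a n * poly (Pc n) (of_real x))"
proof -
  define S where "S = (\<lambda>k x. \<Sum>n<k. a n * poly (Pc n) (complex_of_real x))"
  define F where "F = (\<lambda>x. \<Sum>n. a n * poly (Pc n) (complex_of_real x))"
  have [measurable]: "S k \<in> borel_measurable borel" "F \<in> borel_measurable borel" for k
    unfolding S_def F_def by measurable
  \<comment> \<open>Eventually \<open>norm (a n) < 1\<close>, so the squares are dominated by the
    norms.\<close>
  have sum2: "summable (\<lambda>n. (norm (a n))\<^sup>2)"
  proof (rule summable_comparison_test_ev)
    show "summable (\<lambda>n. norm (a n))" by fact
    have "\<forall>\<^sub>F n in sequentially. norm (a n) < 1"
      using order_tendstoD(2)[OF summable_LIMSEQ_zero[OF assms], of 1] by simp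
    then show "\<forall>\<^sub>F n in sequentially. norm ((norm (a n))\<^sup>2) \<le> norm (a n)"
      by eventually_elim (simp add: power2_eq_square mult_left_le)
  qed
  define T where "T = (\<lambda>k. \<Sum>n. (norm (a (n + k)))\<^sup>2)"
  have sum2_shift: "summable (\<lambda>n. (norm (a (n + k)))\<^sup>2)" for k
    by (rule summable_ignore_initial_segment[OF sum2])
  have T0: "T k \<ge> 0" for k
    unfolding T_def by (rule suminf_nonneg[OF sum2_shift]) simp
  \<comment> \<open>Almost everywhere \<open>F - S k\<close> is the limit of
    \<open>S (m + k) - S k\<close> in \<open>m\<close>. By orthonormality the squared norms of these
    finite sums are partial sums of the tail \<open>T k\<close>, and Fatou's lemma passes to the
    limit.\<close>
  have fatou: "(\<integral>\<^sup>+x. ennreal ((norm (F x - S k x))\<^sup>2) \<partial>\<mu>) \<le> ennreal (T k)" for k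
  proof -
    have "AE x in \<mu>. ennreal ((norm (F x - S k x))\<^sup>2) = liminf (\<lambda>m. ennreal ((norm (S (m + k) x - S k x))\<^sup>2))"
      using AE_summable[OF assms]
    proof eventually_elim
      case (elim x)
      then have "(\<lambda>m. S m x) \<longlonglongrightarrow> F x"
        unfolding S_def F_def by (rule summable_LIMSEQ[OF summable_norm_cancel])
      then have "(\<lambda>m. S (m + k) x) \<longlonglongrightarrow> F x" by (rule LIMSEQ_ignore_initial_segment)
      then have "(\<lambda>m. ennreal ((norm (S (m + k) x - S k x))\<^sup>2)) \<longlonglongrightarrow> ennreal ((norm (F x - S k x))\<^sup>2)"
        by (intro tendsto_intros)
      then show ?case by (rule lim_imp_Liminf[OF sequentially_bot, symmetric])
    qed
    then have "(\<integral>\<^sup>+x. ennreal ((norm (F x - S k x))\<^sup>2) \<partial>\<mu>) =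
      (\<integral>\<^sup>+x. liminf (\<lambda>m. ennreal ((norm (S (m + k) x - S k x))\<^sup>2)) \<partial>\<mu>)"
      by (rule nn_integral_cong_AE)
    also have "\<dots> \<le> liminf (\<lambda>m. \<integral>\<^sup>+x. ennreal ((norm (S (m + k) x - S k x))\<^sup>2) \<partial>\<mu>)"
      by (intro nn_integral_liminf) measurable
    also have "\<dots> \<le> liminf (\<lambda>m::nat. ennreal (T k))"
    proof (intro Liminf_mono always_eventually allI)
      fix m
      have S_diff: "S (m + k) x - S k x = (\<Sum>n\<in>{k..<m + k}. a n * poly (Pc n) (of_real x))" for x
        unfolding S_def by (simp add: sum_diff_nat_ivl lessThan_atLeast0)
      have "(\<integral>\<^sup>+x. ennreal ((norm (S (m + k) x - S k x))\<^sup>2) \<partial>\<mu>) = ennreal (\<Sum>n\<in>{k..<m + k}. (norm (a n))\<^sup>2)"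
        unfolding S_diff using square_integrable_sum[of "{k..<m + k}" a] integral_norm_sum_power2[of "{k..<m + k}" a]
        by (simp add: nn_integral_eq_integral square_integrable_def)
      also have "(\<Sum>n\<in>{k..<m + k}. (norm (a n))\<^sup>2) = (\<Sum>n<m. (norm (a (n + k)))\<^sup>2)"
        using sum.shift_bounds_nat_ivl[of "\<lambda>n. (norm (a n))\<^sup>2" 0 k m] by (simp add: lessThan_atLeast0)
      also have "ennreal \<dots> \<le> ennreal (T k)"
        unfolding T_def by (intro ennreal_leI sum_le_suminf sum2_shift) auto
      finally show "(\<integral>\<^sup>+x. ennreal ((norm (S (m + k) x - S k x))\<^sup>2) \<partial>\<mu>) \<le> ennreal (T k)" .
    qed
    also have "\<dots> = ennreal (T k)" by (simp add: Liminf_const)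
    finally show ?thesis .
  qed
  \<comment> \<open>The case \<open>k = 0\<close> of the Fatou estimate, where \<open>S 0\<close> is
    the empty sum.\<close>
  have sqF: "square_integrable \<mu> F"
    unfolding square_integrable_iff_nn_integral
    using fatou[of 0] le_less_trans[OF _ ennreal_less_top] by (auto simp: S_def)
  have sqS: "square_integrable \<mu> (S k)" for k
    unfolding S_def by (rule square_integrable_sum) simp
  have "(\<lambda>k. norm_L2 \<mu> (\<lambda>x. S k x - F x)) \<longlonglongrightarrow> 0"
  proof (rule tendsto_sandwich[OF _ _ tendsto_const])
    have "T \<longlonglongrightarrow> 0" unfolding T_def by (rule suminf_exist_split2[OF sum2])
    then show "(\<lambda>k. sqrt (T k)) \<longlonglongrightarrow> 0" using tendsto_real_sqrt by fastforce
    have "norm_L2 \<mu> (\<lambda>x. S k x - F x) \<le> sqrt (T k)" for k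
    proof -
      have "ennreal (LINT x|\<mu>. (norm (S k x - F x))\<^sup>2) = (\<integral>\<^sup>+x. ennreal ((norm (F x - S k x))\<^sup>2) \<partial>\<mu>)"
        using square_integrable_diff[OF sqS sqF]
        by (subst nn_integral_eq_integral[symmetric]) (auto simp: square_integrable_def norm_minus_commute)
      with fatou[of k] have "ennreal (LINT x|\<mu>. (norm (S k x - F x))\<^sup>2) \<le> ennreal (T k)" by simp
      then show ?thesis unfolding norm_L2_def by (subst (asm) ennreal_le_iff[OF T0]) simp
    qed
    then show "\<forall>\<^sub>F k in sequentially. norm_L2 \<mu> (\<lambda>x. S k x - F x) \<le> sqrt (T k)" by simp
    show "\<forall>\<^sub>F k in sequentially. 0 \<le> norm_L2 \<mu> (\<lambda>x. S k x - F x)"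
      by (simp add: norm_L2_def)
  qed
  with sqF sqS show ?thesis unfolding converges_in_L2_def F_def S_def by blast
qed

text \<open>The identity is exact for partial sums, and the pairing is continuous under
  \<open>L\<^sup>2\<close> convergence.\<close>

lemma parseval_series:
  assumes "summable (\<lambda>n. norm (a n))" "summable (\<lambda>n. norm (b n))"
  shows "(\<lambda>n. a n * b n) sums
    (LINT x|\<mu>. (\<Sum>n. a n * poly (Pc n) (of_real x)) * (\<Sum>n. b n * poly (Pc n) (of_real x)))"
  unfolding sums_def
  using converges_in_L2_integral_mult[OF converges_in_L2_series[OF assms(1)] converges_in_L2_series[OF assms(2)]]
  by (simp add: integral_sum_mult_sum)

end

subsection \<open>Generating series with locally bounded coefficients\<close>

text \<open>Termwise differentiation of the power series with coefficients \<open>norm (d n)\<close>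
  keeps it convergent inside the disc. This supplies the majorant for the derivative in
  \<open>t\<close>.\<close>

lemma summable_nat_mult_power:
  fixes d :: "nat \<Rightarrow> complex"
  assumes "ereal r < conv_radius d" "0 \<le> r"
  shows "summable (\<lambda>n. norm (d n) * (real n * r ^ (n - 1)))"
proof -
  obtain r' where r': "ereal r < ereal r'" "ereal r' < conv_radius d"
    using ereal_dense2[OF assms(1)] by blast
  have "summable (\<lambda>n. diffs (\<lambda>n. norm (d n)) n * r ^ n)"
  proof (rule termdiff_converges)
    show "norm r < r'" using r'(1) assms(2) by simp
    fix y :: real assume y: "norm y < r'"
    have "ereal (norm (complex_of_real y)) < ereal r'" using y by simp
    then have "summable (\<lambda>n. norm (d n * complex_of_real y ^ n))"
      using r'(2) by (intro abs_summable_in_conv_radius) (rule less_trans)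
    then have "summable (\<lambda>n. norm (norm (d n) * y ^ n))" by (simp add: norm_mult norm_power abs_mult power_abs)
    then show "summable (\<lambda>n. norm (d n) * y ^ n)" by (rule summable_norm_cancel)
  qed
  then have "summable (\<lambda>n. norm (d (Suc n)) * (real (Suc n) * r ^ (Suc n - 1)))"
    by (simp add: diffs_def algebra_simps)
  then show ?thesis by (subst (asm) summable_Suc_iff)
qed

text \<open>Cauchy's estimate on the unit circle around \<open>z\<close>; radius 1 keeps the
  constant \<open>B\<close>.\<close>

lemma norm_poly_pderiv_le:
  fixes q :: "complex poly"
  assumes "\<And>w. norm (w - z) \<le> 1 \<Longrightarrow> norm (poly q w) \<le> B"
  shows "norm (poly (pderiv q) z) \<le> B"
proof -
  have "norm ((deriv ^^ 1) (poly q) z) \<le> fact 1 * B / 1 ^ 1"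
    by (rule Cauchy_inequality[where r = 1])
       (use assms in \<open>auto simp: norm_minus_commute intro!: holomorphic_intros continuous_intros\<close>)
  moreover have "deriv (poly q) z = poly (pderiv q) z"
    by (rule DERIV_imp_deriv) (rule poly_DERIV)
  ultimately show ?thesis by simp
qed

context
  fixes q :: "nat \<Rightarrow> complex poly" and d :: "nat \<Rightarrow> complex"
  assumes locally_bounded: "\<And>R. \<exists>B. \<forall>n z. norm z \<le> R \<longrightarrow> norm (poly (q n) z) \<le> B"
begin

text \<open>The bound on \<open>q n\<close> is uniform in \<open>n\<close>, so the power series in
  \<open>t\<close> alone supplies the decay.\<close>

lemma generating_series_majorant:
  assumes "0 \<le> r" "ereal r < conv_radius d"
  shows "\<exists>M. summable M \<and> (\<forall>n x t. norm x \<le> R \<longrightarrow> norm t \<le> r \<longrightarrow>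
           norm (poly (q n) x * (d n * t ^ n)) \<le> M n)"
proof -
  obtain B where B: "\<And>n z. norm z \<le> R \<Longrightarrow> norm (poly (q n) z) \<le> B"
    using locally_bounded by blast
  have "summable (\<lambda>n. norm (d n * complex_of_real r ^ n))"
    using assms by (intro abs_summable_in_conv_radius) simp
  then have "summable (\<lambda>n. B * (norm (d n) * r ^ n))"
    using assms(1) by (intro summable_mult) (simp add: norm_mult norm_power)
  moreover have "norm (poly (q n) x * (d n * t ^ n)) \<le> B * (norm (d n) * r ^ n)"
    if "norm x \<le> R" "norm t \<le> r" for n x t
    unfolding norm_mult norm_power using B[OF that(1), of n] that(2)
    by (intro mult_mono power_mono) (auto intro: order_trans[OF norm_ge_zero])
  ultimately show ?thesis by blast
qed

lemma generating_series_compact: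
  assumes "compact K" "K \<subseteq> UNIV \<times> eball 0 (conv_radius d)" "0 < conv_radius d"
  shows "\<forall>(x, t)\<in>K. summable (\<lambda>n. norm (poly (q n) x * (d n * t ^ n)))"
    and "uniform_limit K (\<lambda>k (x, t). \<Sum>n<k. poly (q n) x * (d n * t ^ n))
           (\<lambda>(x, t). \<Sum>n. poly (q n) x * (d n * t ^ n)) sequentially"
proof -
  have "compact (fst ` K)" "compact (snd ` K)"
    using assms(1) by (auto intro!: compact_continuous_image continuous_intros)
  then have "bounded (fst ` K)" by (intro compact_imp_bounded)
  then obtain R where R: "\<And>w. w \<in> K \<Longrightarrow> norm (fst w) \<le> R"
    unfolding bounded_iff by blast
  \<comment> \<open>On a nonempty compact \<open>K\<close> the largest modulus of \<open>t\<close>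
    is attained, hence lies strictly below the radius of convergence. For empty \<open>K\<close> the
    choice 0 works, as the radius is positive.\<close>
  obtain r where r: "0 \<le> r" "ereal r < conv_radius d" "\<And>w. w \<in> K \<Longrightarrow> norm (snd w) \<le> r"
  proof (cases "K = {}")
    case True
    with that[of 0] assms(3) show ?thesis by (simp add: zero_ereal_def)
  next
    case False
    then obtain t where t: "t \<in> snd ` K" "\<And>u. u \<in> snd ` K \<Longrightarrow> norm u \<le> norm t"
      using continuous_attains_sup[OF \<open>compact (snd ` K)\<close>, of norm] by (auto intro: continuous_intros)
    with assms(2) that[of "norm t"] show ?thesis by force
  qed
  obtain M where M: "summable M" "\<And>n x t. norm x \<le> R \<Longrightarrow> norm t \<le> r \<Longrightarrow>
           norm (poly (q n) x * (d n * t ^ n)) \<le> M n"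
    using generating_series_majorant[OF r(1,2)] by blast
  have le: "norm (poly (q n) (fst w) * (d n * snd w ^ n)) \<le> M n" if "w \<in> K" for n w
    using M(2) R r(3) that by blast
  show "\<forall>(x, t)\<in>K. summable (\<lambda>n. norm (poly (q n) x * (d n * t ^ n)))"
    using le by (fastforce intro!: summable_comparison_test'[OF M(1)])
  show "uniform_limit K (\<lambda>k (x, t). \<Sum>n<k. poly (q n) x * (d n * t ^ n))
           (\<lambda>(x, t). \<Sum>n. poly (q n) x * (d n * t ^ n)) sequentially"
    unfolding case_prod_unfold by (rule Weierstrass_m_test[OF le M(1)])
qed

text \<open>Termwise differentiation on a convex neighbourhood of the point: the series of both
  partial derivatives converge uniformly there, so the differentials converge uniformly in operator
  norm.\<close>

lemma generating_series_holomorphic2: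
  "holomorphic2_on (\<lambda>(x, t). \<Sum>n. poly (q n) x * (d n * t ^ n)) (UNIV \<times> eball 0 (conv_radius d))"
  unfolding holomorphic2_on_def
proof
  fix w :: "complex \<times> complex" assume w: "w \<in> UNIV \<times> eball 0 (conv_radius d)"
  obtain x0 t0 where w_eq: "w = (x0, t0)" by (cases w)
  with w have "ereal (norm t0) < conv_radius d" by simp
  then obtain r where r: "norm t0 < r" "ereal r < conv_radius d"
    using ereal_dense2 by force
  then have r0: "0 \<le> r" using norm_ge_zero[of t0] by linarith
  define S where "S = ball x0 1 \<times> ball t0 (r - norm t0)"
  have S: "convex S" "open S" "w \<in> S"
    using r by (auto simp: S_def w_eq intro: convex_Times open_Times)
  have S_le: "norm (fst u) \<le> norm x0 + 1" "norm (snd u) \<le> r" if "u \<in> S" for u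
    using that norm_triangle_ineq2[of "fst u" x0] norm_triangle_ineq2[of "snd u" t0]
    by (auto simp: S_def dist_norm norm_minus_commute)
  \<comment> \<open>On \<open>S\<close> the first coordinate has modulus at most
    \<open>norm x0 + 1\<close>; Cauchy's estimate for the derivative needs one further unit.\<close>
  obtain B where B: "\<And>n z. norm z \<le> norm x0 + 2 \<Longrightarrow> norm (poly (q n) z) \<le> B"
    using locally_bounded by blast
  have B0: "0 \<le> B" by (rule order_trans[OF norm_ge_zero B[of 0 0]]) simp
  define a where "a = (\<lambda>n (u::complex \<times> complex). poly (pderiv (q n)) (fst u) * (d n * snd u ^ n))"
  define b where "b = (\<lambda>n (u::complex \<times> complex). poly (q n) (fst u) * (d n * (of_nat n * snd u ^ (n - 1))))"
  have a_le: "norm (a n u) \<le> B * (norm (d n) * r ^ n)" if "u \<in> S" for n u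
  proof -
    have "norm (poly (pderiv (q n)) (fst u)) \<le> B"
    proof (rule norm_poly_pderiv_le)
      fix z assume "norm (z - fst u) \<le> 1"
      then show "norm (poly (q n) z) \<le> B"
        using S_le(1)[OF that] norm_triangle_ineq2[of z "fst u"] by (intro B) linarith
    qed
    then show ?thesis
      unfolding a_def norm_mult norm_power using S_le(2)[OF that] B0
      by (intro mult_mono power_mono) auto
  qed
  have b_le: "norm (b n u) \<le> B * (norm (d n) * (real n * r ^ (n - 1)))" if "u \<in> S" for n u
  proof -
    have "norm (poly (q n) (fst u)) \<le> B" using S_le(1)[OF that] by (intro B) linarith
    then show ?thesis
      unfolding b_def norm_mult norm_power norm_of_nat using S_le(2)[OF that] B0 r0
      by (intro mult_mono power_mono) auto
  qed
  have "summable (\<lambda>n. norm (d n * complex_of_real r ^ n))"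
    using r0 r(2) by (intro abs_summable_in_conv_radius) simp
  then have "summable (\<lambda>n. B * (norm (d n) * r ^ n))"
    using r0 by (intro summable_mult) (simp add: norm_mult norm_power)
  from Weierstrass_m_test[OF a_le this]
  have lim_a: "uniform_limit S (\<lambda>k u. \<Sum>n<k. a n u) (\<lambda>u. \<Sum>n. a n u) sequentially" .
  have "summable (\<lambda>n. B * (norm (d n) * (real n * r ^ (n - 1))))"
    by (intro summable_mult summable_nat_mult_power r r0)
  from Weierstrass_m_test[OF b_le this]
  have lim_b: "uniform_limit S (\<lambda>k u. \<Sum>n<k. b n u) (\<lambda>u. \<Sum>n. b n u) sequentially" .
  obtain M where M: "summable M" "\<And>n x t. norm x \<le> norm x0 + 1 \<Longrightarrow> norm t \<le> r \<Longrightarrow>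
           norm (poly (q n) x * (d n * t ^ n)) \<le> M n"
    using generating_series_majorant[OF r0 r(2)] by blast
  have "\<exists>g. \<forall>u\<in>S. (\<lambda>n. poly (q n) (fst u) * (d n * snd u ^ n)) sums (g u) \<and>
     (g has_derivative (\<lambda>h. (\<Sum>n. a n u) * fst h + (\<Sum>n. b n u) * snd h)) (at u within S)"
  proof (rule has_derivative_series[where f' = "\<lambda>n u h. a n u * fst h + b n u * snd h"])
    show "convex S" "w \<in> S" using S by auto
    have "summable (\<lambda>n. poly (q n) (fst w) * (d n * snd w ^ n))"
      using S_le[OF S(3)] by (intro summable_comparison_test'[OF M(1) M(2)])
    then show "(\<lambda>n. poly (q n) (fst w) * (d n * snd w ^ n)) sums
        (\<Sum>n. poly (q n) (fst w) * (d n * snd w ^ n))" by (rule summable_sums)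
  next
    fix n u assume "u \<in> S"
    have "((\<lambda>u. poly (q n) (fst u)) has_derivative (\<lambda>h. poly (pderiv (q n)) (fst u) * fst h)) (at u within S)"
      by (rule has_derivative_compose[OF has_derivative_fst[OF has_derivative_ident]
            poly_DERIV[unfolded has_field_derivative_def]])
    moreover have "((\<lambda>u. snd u ^ n) has_derivative (\<lambda>h. of_nat n * snd u ^ (n - 1) * snd h)) (at u within S)"
      by (auto intro!: derivative_eq_intros simp: algebra_simps)
    ultimately show "((\<lambda>u. poly (q n) (fst u) * (d n * snd u ^ n)) has_derivative
       (\<lambda>h. a n u * fst h + b n u * snd h)) (at u within S)"
      by (auto intro!: derivative_eq_intros simp: a_def b_def algebra_simps)
  next
    \<comment> \<open>An error below \<open>e / 2\<close> in each partial derivative gives an error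
      of at most \<open>e * norm h\<close> in the differential.\<close>
    fix e :: real assume "e > 0"
    then have e2: "e / 2 > 0" by simp
    have "\<forall>\<^sub>F k in sequentially. (\<forall>u\<in>S. dist (\<Sum>n<k. a n u) (\<Sum>n. a n u) < e / 2) \<and>
        (\<forall>u\<in>S. dist (\<Sum>n<k. b n u) (\<Sum>n. b n u) < e / 2)"
      by (intro eventually_conj uniform_limitD[OF lim_a e2] uniform_limitD[OF lim_b e2])
    then show "\<forall>\<^sub>F k in sequentially. \<forall>u\<in>S. \<forall>h. norm ((\<Sum>i<k. a i u * fst h + b i u * snd h) -
        ((\<Sum>n. a n u) * fst h + (\<Sum>n. b n u) * snd h)) \<le> e * norm h"
    proof (eventually_elim, intro ballI allI)
      fix k u and h :: "complex \<times> complex"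
      assume *: "(\<forall>u\<in>S. dist (\<Sum>n<k. a n u) (\<Sum>n. a n u) < e / 2) \<and>
        (\<forall>u\<in>S. dist (\<Sum>n<k. b n u) (\<Sum>n. b n u) < e / 2)" and u: "u \<in> S"
      have "(\<Sum>i<k. a i u * fst h + b i u * snd h) - ((\<Sum>n. a n u) * fst h + (\<Sum>n. b n u) * snd h)
        = ((\<Sum>n<k. a n u) - (\<Sum>n. a n u)) * fst h + ((\<Sum>n<k. b n u) - (\<Sum>n. b n u)) * snd h"
        by (simp add: sum.distrib sum_distrib_left algebra_simps)
      also have "norm \<dots> \<le> e / 2 * norm h + e / 2 * norm h"
      proof (intro norm_triangle_mono)
        have h: "norm (fst h) \<le> norm h" "norm (snd h) \<le> norm h"
          using norm_fst_le[of "fst h" "snd h"] norm_snd_le[of "snd h" "fst h"] by simp_all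
        show "norm (((\<Sum>n<k. a n u) - (\<Sum>n. a n u)) * fst h) \<le> e / 2 * norm h"
          unfolding norm_mult using * u h(1) e2 by (intro mult_mono) (auto simp: dist_norm less_imp_le)
        show "norm (((\<Sum>n<k. b n u) - (\<Sum>n. b n u)) * snd h) \<le> e / 2 * norm h"
          unfolding norm_mult using * u h(2) e2 by (intro mult_mono) (auto simp: dist_norm less_imp_le)
      qed
      finally show "norm ((\<Sum>i<k. a i u * fst h + b i u * snd h) -
        ((\<Sum>n. a n u) * fst h + (\<Sum>n. b n u) * snd h)) \<le> e * norm h" by simp
    qed
  qed
  then obtain g where g: "\<And>u. u \<in> S \<Longrightarrow> (\<lambda>n. poly (q n) (fst u) * (d n * snd u ^ n)) sums g u"
    "\<And>u. u \<in> S \<Longrightarrow> (g has_derivative (\<lambda>h. (\<Sum>n. a n u) * fst h + (\<Sum>n. b n u) * snd h)) (at u within S)"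
    by blast
  have "(g has_derivative (\<lambda>h. (\<Sum>n. a n w) * fst h + (\<Sum>n. b n w) * snd h)) (at w)"
    using g(2)[OF S(3)] at_within_open[OF S(3,2)] by simp
  then have "((\<lambda>(x, t). \<Sum>n. poly (q n) x * (d n * t ^ n)) has_derivative
      (\<lambda>h. (\<Sum>n. a n w) * fst h + (\<Sum>n. b n w) * snd h)) (at w)"
    by (rule has_derivative_transform_within_open[OF _ S(2,3)])
       (use g(1) in \<open>auto simp: case_prod_unfold sums_iff\<close>)
  then show "\<exists>a b. ((\<lambda>(x, t). \<Sum>n. poly (q n) x * (d n * t ^ n)) has_derivative
      (\<lambda>(h, k). a * h + b * k)) (at w)"
    unfolding case_prod_unfold by blast
qed

end

subsection \<open>The generating function\<close>

text \<open>Otherwise \<open>p\<close> vanishes almost everywhere, so the open complement of its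
  root set is null and the support lies among finitely many roots.\<close>

lemma integral_poly_mult_self_pos:
  assumes mom: "has_all_moments \<mu>" and supp: "infinite (measure_support \<mu>)" and "p \<noteq> 0"
  shows "0 < (LINT x|\<mu>. poly p x * poly p x)"
proof (rule ccontr)
  assume neg: "\<not> ?thesis"
  have sets: "sets \<mu> = sets borel" using mom by (simp add: has_all_moments_def)
  note [measurable_cong] = sets
  have sp: "space \<mu> = UNIV" using sets_eq_imp_space_eq[OF sets] by simp
  have "integrable \<mu> (\<lambda>x. Re (poly (map_poly complex_of_real (p * p)) (complex_of_real x)))"
    by (intro integrable_Re integrable_complex_poly mom)
  then have int: "integrable \<mu> (\<lambda>x. poly p x * poly p x)"
    by (simp add: poly_map_poly_complex_of_real)
  have "(LINT x|\<mu>. poly p x * poly p x) = 0"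
    using neg by (intro antisym integral_nonneg_AE) auto
  then have "AE x in \<mu>. poly p x * poly p x = 0"
    using int by (subst (asm) integral_nonneg_eq_0_iff_AE) auto
  then have "AE x in \<mu>. poly p x = 0" by simp
  moreover have closed: "closed {x. poly p x = 0}" 
    by (intro finite_imp_closed poly_roots_finite \<open>p \<noteq> 0\<close>)
  ultimately have null: "emeasure \<mu> {x. poly p x \<noteq> 0} = 0"
    by (subst (asm) AE_iff_measurable[OF _ refl]) (auto simp: sp sets Collect_neg_eq)
  have "measure_support \<mu> \<subseteq> {x. poly p x = 0}"
  proof
    fix x assume x: "x \<in> measure_support \<mu>"
    have "open {x. poly p x \<noteq> 0}" using closed by (simp add: Collect_neg_eq open_closed)
    with x null show "x \<in> {x. poly p x = 0}"
      unfolding measure_support_def by force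
  qed
  with supp poly_roots_finite[OF \<open>p \<noteq> 0\<close>] show False using finite_subset by blast
qed

theorem proposition1p1:
  fixes \<mu> :: "real measure"
    and p :: "nat \<Rightarrow> real poly"
    and \<zeta> :: "nat \<Rightarrow> real"
    and c :: "nat \<Rightarrow> complex"
    and \<rho> :: ereal
  assumes "has_all_moments \<mu>"
    and "infinite (measure_support \<mu>)"
    and "\<And>n. p n \<noteq> 0 \<and> degree (p n) = n"
    and "\<And>m n. (LINT x|\<mu>. poly (p n) x * poly (p m) x) = (if m = n then \<zeta> n else 0)"
    and "\<And>n. c n \<noteq> 0"
    and "conv_radius (\<lambda>n. complex_of_real (sqrt (\<zeta> n)) / c n) = \<rho>"
    and "0 < \<rho>"
  shows
    "((\<exists>N\<in>null_sets \<mu>. \<forall>t\<in>eball 0 \<rho>. \<forall>x\<in>- N.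
          summable (\<lambda>n. norm (gen_term p c n (complex_of_real x) t))) \<and>
      (\<forall>t\<in>eball 0 \<rho>.
          converges_in_L2 \<mu> (\<lambda>k x. \<Sum>n<k. gen_term p c n (complex_of_real x) t)
            (\<lambda>x. gen_fun p c (complex_of_real x) t)) \<and>
      (\<forall>t1\<in>eball 0 \<rho>. \<forall>t2\<in>eball 0 \<rho>.
          integrable \<mu> (\<lambda>x. gen_fun p c (complex_of_real x) t1 * gen_fun p c (complex_of_real x) t2) \<and>
          (\<lambda>n. complex_of_real (\<zeta> n) * ((t1 * t2) ^ n / (c n)\<^sup>2)) sums
            (LINT x|\<mu>. gen_fun p c (complex_of_real x) t1 * gen_fun p c (complex_of_real x) t2)))
     \<and>
     (indeterminate \<mu> \<longrightarrow>
        (\<forall>K. compact K \<and> K \<subseteq> UNIV \<times> eball 0 \<rho> \<longrightarrow>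
           (\<forall>(x, t)\<in>K. summable (\<lambda>n. norm (gen_term p c n x t))) \<and>
           uniform_limit K (\<lambda>k (x, t). \<Sum>n<k. gen_term p c n x t) (\<lambda>(x, t). gen_fun p c x t)
             sequentially) \<and>
        holomorphic2_on (\<lambda>(x, t). gen_fun p c x t) (UNIV \<times> eball 0 \<rho>))"
proof -
  \<comment> \<open>Infinite support enters here; positivity permits division by
    \<open>sqrt (\<zeta> n)\<close>.\<close>
  have \<zeta>_pos: "\<zeta> n > 0" for n
    using integral_poly_mult_self_pos[OF assms(1,2), of "p n"] assms(3)[of n] assms(4)[of n n] by simp
  define P where "P = (\<lambda>n. smult (1 / sqrt (\<zeta> n)) (p n))"
  define d where "d = (\<lambda>n. complex_of_real (sqrt (\<zeta> n)) / c n)"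
  interpret orthonormal_polynomials \<mu> P
  proof
    fix m n
    have "(LINT x|\<mu>. poly (P n) x * poly (P m) x)
       = (LINT x|\<mu>. 1 / (sqrt (\<zeta> n) * sqrt (\<zeta> m)) * (poly (p n) x * poly (p m) x))"
      by (simp add: P_def)
    also have "\<dots> = 1 / (sqrt (\<zeta> n) * sqrt (\<zeta> m)) * (if m = n then \<zeta> n else 0)"
      by (simp only: integral_mult_right_zero assms(4))
    also have "\<dots> = of_bool (m = n)"
      using \<zeta>_pos[of n] by simp
    finally show "(LINT x|\<mu>. poly (P n) x * poly (P m) x) = of_bool (m = n)" .
  qed (use assms(1,3) \<zeta>_pos in \<open>auto simp: P_def less_imp_neq[symmetric] intro: less_imp_neq[symmetric]\<close>)
  have Pc: "Pc n = smult (complex_of_real (1 / sqrt (\<zeta> n))) (map_poly complex_of_real (p n))" for n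
    by (rule poly_eqI) (simp add: P_def coeff_map_poly)
  have term_eq: "gen_term p c n x t = d n * t ^ n * poly (Pc n) x" for n x t
    using \<zeta>_pos[of n] by (simp add: gen_term_def Pc d_def)
  have fun_eq: "gen_fun p c x t = (\<Sum>n. d n * t ^ n * poly (Pc n) x)" for x t
    by (simp add: gen_fun_def term_eq)
  have rho: "conv_radius d = \<rho>" using assms(6) by (simp add: d_def)
  have summ: "summable (\<lambda>n. norm (d n * t ^ n))" if "t \<in> eball 0 \<rho>" for t
    using that by (intro abs_summable_in_conv_radius) (simp add: rho)
  \<comment> \<open>Restricting to rational radii leaves countably many conditions, so a single null
    set serves all \<open>t\<close>.\<close>
  define Q where "Q = (\<lambda>x. \<forall>r::rat. 0 \<le> r \<and> ereal (of_rat r) < \<rho> \<longrightarrow>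
     summable (\<lambda>n. norm (d n * complex_of_real (of_rat r) ^ n * poly (Pc n) (of_real x))))"
  have "AE x in \<mu>. Q x"
    unfolding Q_def AE_all_countable
  proof
    fix r :: rat
    show "AE x in \<mu>. 0 \<le> r \<and> ereal (of_rat r) < \<rho> \<longrightarrow>
      summable (\<lambda>n. norm (d n * complex_of_real (of_rat r) ^ n * poly (Pc n) (of_real x)))"
    proof (cases "0 \<le> r \<and> ereal (of_rat r) < \<rho>")
      case True
      then have "complex_of_real (of_rat r) \<in> eball 0 \<rho>" by simp
      from AE_summable[OF summ[OF this]] show ?thesis by eventually_elim simp
    qed auto
  qed
  then obtain N where N: "N \<in> null_sets \<mu>" "{x \<in> space \<mu>. \<not> Q x} \<subseteq> N"
    unfolding eventually_ae_filter by blast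
  have N': "summable (\<lambda>n. norm (d n * complex_of_real (of_rat r) ^ n * poly (Pc n) (of_real x)))"
    if "x \<notin> N" "0 \<le> r" "ereal (of_rat r) < \<rho>" for x r
  proof -
    have "Q x" using N(2) that(1) sets_eq_imp_space_eq[OF sets_eq_borel] by auto
    with that(2,3) show ?thesis by (simp only: Q_def)
  qed
  have "summable (\<lambda>n. norm (gen_term p c n (complex_of_real x) t))" if t: "t \<in> eball 0 \<rho>" and x: "x \<in> - N" for t x
  proof -
    \<comment> \<open>A rational radius between the modulus of \<open>t\<close> and
      \<open>\<rho>\<close> dominates the series at \<open>t\<close> term by term.\<close>
    obtain r where r: "ereal (norm t) < ereal (of_rat r)" "ereal (of_rat r) < \<rho>"
      using t ereal_dense3[of "ereal (norm t)" \<rho>] by auto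
    then have r0: "norm t \<le> real_of_rat r" by simp
    have "0 \<le> real_of_rat r" using r0 norm_ge_zero[of t] by linarith
    then have r1: "0 \<le> r" by simp
    show ?thesis
    proof (rule summable_comparison_test'[OF N'[of x r]])
      fix n :: nat
      show "norm (norm (gen_term p c n (complex_of_real x) t)) \<le>
        norm (d n * complex_of_real (of_rat r) ^ n * poly (Pc n) (of_real x))"
        unfolding term_eq using r0 r1
        by (auto simp: norm_mult norm_power intro!: mult_right_mono mult_left_mono power_mono)
    qed (use x r r1 in auto)
  qed
  with N(1) have part_i_a: "\<exists>N\<in>null_sets \<mu>. \<forall>t\<in>eball 0 \<rho>. \<forall>x\<in>- N.
      summable (\<lambda>n. norm (gen_term p c n (complex_of_real x) t))" by blast
  have part_i_b: "converges_in_L2 \<mu> (\<lambda>k x. \<Sum>n<k. gen_term p c n (complex_of_real x) t)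
      (\<lambda>x. gen_fun p c (complex_of_real x) t)" if "t \<in> eball 0 \<rho>" for t
    unfolding term_eq fun_eq by (rule converges_in_L2_series[OF summ[OF that]])
  have part_i_c: "integrable \<mu> (\<lambda>x. gen_fun p c (complex_of_real x) t1 * gen_fun p c (complex_of_real x) t2)"
    if "t1 \<in> eball 0 \<rho>" "t2 \<in> eball 0 \<rho>" for t1 t2
    using part_i_b[OF that(1)] part_i_b[OF that(2)] unfolding converges_in_L2_def
    by (intro integrable_mult_square_integrable) auto
  have part_i_d: "(\<lambda>n. complex_of_real (\<zeta> n) * ((t1 * t2) ^ n / (c n)\<^sup>2)) sums
      (LINT x|\<mu>. gen_fun p c (complex_of_real x) t1 * gen_fun p c (complex_of_real x) t2)"
    if "t1 \<in> eball 0 \<rho>" "t2 \<in> eball 0 \<rho>" for t1 t2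
  proof -
    have "complex_of_real (\<zeta> n) * ((t1 * t2) ^ n / (c n)\<^sup>2) = (d n * t1 ^ n) * (d n * t2 ^ n)" for n
    proof -
      have "complex_of_real (\<zeta> n) = complex_of_real (sqrt (\<zeta> n)) * complex_of_real (sqrt (\<zeta> n))"
        using \<zeta>_pos[of n] by (simp flip: of_real_mult)
      then show ?thesis by (simp add: d_def power2_eq_square power_mult_distrib)
    qed
    then show ?thesis
      unfolding fun_eq using parseval_series[OF summ[OF that(1)] summ[OF that(2)]] by simp
  qed
  have part_ii: "(\<forall>K. compact K \<and> K \<subseteq> UNIV \<times> eball 0 \<rho> \<longrightarrow>
           (\<forall>(x, t)\<in>K. summable (\<lambda>n. norm (gen_term p c n x t))) \<and>
           uniform_limit K (\<lambda>k (x, t). \<Sum>n<k. gen_term p c n x t) (\<lambda>(x, t). gen_fun p c x t)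
             sequentially) \<and>
        holomorphic2_on (\<lambda>(x, t). gen_fun p c x t) (UNIV \<times> eball 0 \<rho>)" if "indeterminate \<mu>"
  proof -
    have eq: "gen_term p c n x t = poly (Pc n) x * (d n * t ^ n)" for n x t
      by (simp add: term_eq)
    note bnd = locally_bounded_if_indeterminate[OF that]
    have pos: "0 < conv_radius d" using assms(7) rho by simp
    show ?thesis
      unfolding eq gen_fun_def rho[symmetric]
    proof (intro conjI allI impI)
      fix K :: "(complex \<times> complex) set"
      assume K: "compact K \<and> K \<subseteq> UNIV \<times> eball 0 (conv_radius d)"
      show "\<forall>(x, t)\<in>K. summable (\<lambda>n. norm (poly (Pc n) x * (d n * t ^ n)))"
        by (rule generating_series_compact(1)[of Pc, OF bnd conjunct1[OF K] conjunct2[OF K] pos])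
      show "uniform_limit K (\<lambda>k (x, t). \<Sum>n<k. poly (Pc n) x * (d n * t ^ n))
          (\<lambda>(x, t). \<Sum>n. poly (Pc n) x * (d n * t ^ n)) sequentially"
        by (rule generating_series_compact(2)[of Pc, OF bnd conjunct1[OF K] conjunct2[OF K] pos])
    next
      show "holomorphic2_on (\<lambda>(x, t). \<Sum>n. poly (Pc n) x * (d n * t ^ n))
          (UNIV \<times> eball 0 (conv_radius d))"
        by (rule generating_series_holomorphic2[of Pc d, OF bnd])
    qed
  qed
  show ?thesis
    by (intro conjI ballI impI part_i_a part_i_b part_i_c part_i_d part_ii)
qed

end
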